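(* Let $n\ge 1$ and let $\Omega\subset\mathbb{R}^n$ be a non-empty open set for which there are $j\in\{1,\dots,n\}$ and $c>0$ with $\|\partial^{e_j}f\|_2\ge c\,\|f\|_2$ for all $f\in W^1_{0,\mathbb{C}}(\Omega)$. Let $\bar p_1,\bar p_2,\dots$ be a uniformly bounded sequence in $\mathcal{L}$ for which there is $\varepsilon>0$ such that $\bar p_\nu\ge\varepsilon$ (a.e. on $\Omega$) for all $\nu\in\{1,2,\dots\}$, and which converges a.e. pointwise on $\Omega$ to some $\bar p_\infty\in\mathcal{L}$. Let $A_\nu:=A_{\bar p_\nu}$ for $\nu\in\{1,2,\dots\}$ and $A_\infty:=A_{\bar p_\infty}$ be the associated self-adjoint diffusion operators, and put $p_\nu:=1/\bar p_\nu$, $p_\infty:=1/\bar p_\infty$. Then for every $f\in L^2_{\mathbb{C}}(\Omega)$, $$\lim_{\nu\to\infty}\|A_\nu^{-1}f-A_\infty^{-1}f\|_2=\lim_{\nu\to\infty}\|p_\nu\nabla_w A_\nu^{-1}f-p_\infty\nabla_w A_\infty^{-1}f\|_{2,n}=0.$$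
   Context: $L^2_{\mathbb{C}}(\Omega)$ is the Hilbert space of complex-valued square-integrable functions (Lebesgue measure) with $\langle f|g\rangle_2=\int_\Omega f^*g$ and norm $\|\cdot\|_2$; $(L^2_{\mathbb{C}}(\Omega))^k$ carries $\langle f|g\rangle_{2,k}=\sum_{j=1}^k\langle f_j|g_j\rangle_2$ and norm $\|\cdot\|_{2,k}$. $\partial^{e_k}$ is the $k$-th weak partial derivative in $L^2_{\mathbb{C}}(\Omega)$, i.e. $-1$ times the adjoint of $C_0^\infty(\Omega,\mathbb{C})\to L^2_{\mathbb{C}}(\Omega)$, $f\mapsto\partial f/\partial x_k$. $W^1_{\mathbb{C}}(\Omega)$ is the Sobolev space $\bigcap_{k=1}^n D(\partial^{e_k})$ with norm given by $\|f\|_2^2+\sum_k\|\partial^{e_k}f\|_2^2$ (squared), and $W^1_{0,\mathbb{C}}(\Omega)$ is the closure of $C_0^\infty(\Omega,\mathbb{C})$ in it. $\nabla_0:C_0^\infty(\Omega,\mathbb{C})\to(L^2_{\mathbb{C}}(\Omega))^n$ is the classical gradient, viewed as a densely-defined operator in $L^2_{\mathbb{C}}(\Omega)$; $\nabla_0^*$ is its Hilbert space adjoint, with domain $D(\nabla_0^* )\subset(L^2_{\mathbb{C}}(\Omega))^n$ and values in $L^2_{\mathbb{C}}(\Omega)$; $\nabla_w f=(\partial^{e_1}f,\dots,\partial^{e_n}f)$ for $f\in W^1_{\mathbb{C}}(\Omega)$. $\mathcal{L}$ is the set of real-valued $\bar p\in L^\infty(\Omega)$ for which there are real $C_2\ge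 C_1>0$ with $C_1\le\bar p\le C_2$ a.e. on $\Omega$. For $\bar p\in\mathcal{L}$, $A_{\bar p}$ is the operator in $L^2_{\mathbb{C}}(\Omega)$ with domain $D(A_{\bar p})=\{u\in W^1_{0,\mathbb{C}}(\Omega):(1/\bar p)\nabla_w u\in D(\nabla_0^* )\}$ and $A_{\bar p}u=\nabla_0^*\,(1/\bar p)\nabla_w u$. For $\Omega$ as in the claim it is self-adjoint and bijective. "Uniformly bounded" means $\sup_\nu\|\bar p_\nu\|_\infty<\infty$. *)

theory Defs
  imports "HOL-Analysis.Analysis" "HOL-Probability.Essential_Supremum"
begin

text \<open>
  Elements of the Lebesgue spaces over \<open>\<Omega>\<close> are represented by functions on the whole space of
  which only the values on \<open>\<Omega>\<close> matter, up to equality almost everywhere.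
\<close>

type_synonym 'n cfun = "real ^ 'n \<Rightarrow> complex"

definition L2 :: "(real ^ 'n) set \<Rightarrow> 'n::finite cfun set" where
  "L2 \<Omega> = {f. f \<in> borel_measurable (lebesgue_on \<Omega>) \<and>
              integrable (lebesgue_on \<Omega>) (\<lambda>x. (cmod (f x))\<^sup>2)}"

definition L2_inner :: "(real ^ 'n) set \<Rightarrow> 'n::finite cfun \<Rightarrow> 'n cfun \<Rightarrow> complex" where
  "L2_inner \<Omega> f g = (LINT x|lebesgue_on \<Omega>. cnj (f x) * g x)"

definition L2_norm :: "(real ^ 'n) set \<Rightarrow> 'n::finite cfun \<Rightarrow> real" where
  "L2_norm \<Omega> f = sqrt (LINT x|lebesgue_on \<Omega>. (cmod (f x))\<^sup>2)"

definition L2k :: "(real ^ 'n) set \<Rightarrow> ('k::finite \<Rightarrow> 'n::finite cfun) set" where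
  "L2k \<Omega> = {F. \<forall>j. F j \<in> L2 \<Omega>}"

definition L2k_inner ::
  "(real ^ 'n) set \<Rightarrow> ('k::finite \<Rightarrow> 'n::finite cfun) \<Rightarrow> ('k \<Rightarrow> 'n cfun) \<Rightarrow> complex" where
  "L2k_inner \<Omega> F G = (\<Sum>j\<in>UNIV. L2_inner \<Omega> (F j) (G j))"

definition L2k_norm :: "(real ^ 'n) set \<Rightarrow> ('k::finite \<Rightarrow> 'n::finite cfun) \<Rightarrow> real" where
  "L2k_norm \<Omega> F = sqrt (\<Sum>j\<in>UNIV. (L2_norm \<Omega> (F j))\<^sup>2)"

definition Linf_norm :: "(real ^ 'n) set \<Rightarrow> (real ^ 'n::finite \<Rightarrow> real) \<Rightarrow> ereal" where
  "Linf_norm \<Omega> p = esssup (lebesgue_on \<Omega>) (\<lambda>x. ereal \<bar>p x\<bar>)"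

definition Linf :: "(real ^ 'n) set \<Rightarrow> (real ^ 'n::finite \<Rightarrow> real) set" where
  "Linf \<Omega> = {p. p \<in> borel_measurable (lebesgue_on \<Omega>) \<and> Linf_norm \<Omega> p < \<infinity>}"

definition coeffs_L :: "(real ^ 'n) set \<Rightarrow> (real ^ 'n::finite \<Rightarrow> real) set" where
  "coeffs_L \<Omega> = {p \<in> Linf \<Omega>. \<exists>C1 C2. 0 < C1 \<and> C1 \<le> C2 \<and>
                    (AE x in lebesgue_on \<Omega>. C1 \<le> p x \<and> p x \<le> C2)}"

definition pderiv_k :: "'n \<Rightarrow> 'n::finite cfun \<Rightarrow> 'n cfun" where
  "pderiv_k k f = (\<lambda>x. frechet_derivative f (at x) (axis k 1))"

primrec C_k :: "nat \<Rightarrow> 'n::finite cfun \<Rightarrow> bool" where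
  "C_k 0 f \<longleftrightarrow> continuous_on UNIV f"
| "C_k (Suc m) f \<longleftrightarrow> (\<forall>x. f differentiable (at x)) \<and> (\<forall>k. C_k m (pderiv_k k f))"

text \<open>Test functions on \<open>\<Omega>\<close> are identified with their extensions by zero.\<close>

definition test_funs :: "(real ^ 'n) set \<Rightarrow> 'n::finite cfun set" where
  "test_funs \<Omega> = {\<phi>. (\<forall>m. C_k m \<phi>) \<and> compact (closure {x. \<phi> x \<noteq> 0}) \<and>
                     closure {x. \<phi> x \<noteq> 0} \<subseteq> \<Omega>}"

definition grad :: "'n::finite cfun \<Rightarrow> 'n \<Rightarrow> 'n cfun" where
  "grad \<phi> = (\<lambda>k. pderiv_k k \<phi>)"

text \<open>
  Operators between Lebesgue spaces are given by graphs that are closed under almost everywhere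
  equality in both components; they are single-valued up to almost everywhere equality only.
  Accordingly, the value of an operator at a point of its domain is a representative, and the
  inverse of an operator is the converse of its graph.
\<close>

definition op_apply :: "('a \<times> 'b) set \<Rightarrow> 'a \<Rightarrow> 'b" where
  "op_apply G f = (SOME g. (f, g) \<in> G)"

text \<open>
  The adjoint of an operator \<open>T\<close> with domain \<open>D\<close> from the Hilbert space \<open>X\<close> to the Hilbert
  space \<open>Y\<close>, where \<open>ipX\<close> and \<open>ipY\<close> are the inner products, linear in the second argument.
\<close>

definition adjoint_graph ::
  "'a set \<Rightarrow> ('a \<Rightarrow> 'a \<Rightarrow> complex) \<Rightarrow> 'b set \<Rightarrow> ('b \<Rightarrow> 'b \<Rightarrow> complex) \<Rightarrow>
   'a set \<Rightarrow> ('a \<Rightarrow> 'b) \<Rightarrow> ('b \<times> 'a) set" where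
  "adjoint_graph X ipX Y ipY D T =
     {(g, h). g \<in> Y \<and> h \<in> X \<and> (\<forall>\<phi>\<in>D. ipY g (T \<phi>) = ipX h \<phi>)}"

definition weak_pderiv_graph :: "(real ^ 'n) set \<Rightarrow> 'n \<Rightarrow> ('n::finite cfun \<times> 'n cfun) set" where
  "weak_pderiv_graph \<Omega> k = {(f, \<lambda>x. - h x) | f h. (f, h) \<in>
     adjoint_graph (L2 \<Omega>) (L2_inner \<Omega>) (L2 \<Omega>) (L2_inner \<Omega>) (test_funs \<Omega>) (pderiv_k k)}"

definition weak_pderiv :: "(real ^ 'n) set \<Rightarrow> 'n \<Rightarrow> 'n::finite cfun \<Rightarrow> 'n cfun" where
  "weak_pderiv \<Omega> k = op_apply (weak_pderiv_graph \<Omega> k)"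

definition weak_grad :: "(real ^ 'n) set \<Rightarrow> 'n::finite cfun \<Rightarrow> 'n \<Rightarrow> 'n cfun" where
  "weak_grad \<Omega> f = (\<lambda>k. weak_pderiv \<Omega> k f)"

definition grad_adjoint_graph ::
  "(real ^ 'n) set \<Rightarrow> (('n \<Rightarrow> 'n::finite cfun) \<times> 'n cfun) set" where
  "grad_adjoint_graph \<Omega> =
     adjoint_graph (L2 \<Omega>) (L2_inner \<Omega>) (L2k \<Omega>) (L2k_inner \<Omega>) (test_funs \<Omega>) grad"

definition W1 :: "(real ^ 'n) set \<Rightarrow> 'n::finite cfun set" where
  "W1 \<Omega> = (\<Inter>k. Domain (weak_pderiv_graph \<Omega> k))"

definition W1_norm :: "(real ^ 'n) set \<Rightarrow> 'n::finite cfun \<Rightarrow> real" where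
  "W1_norm \<Omega> f = sqrt ((L2_norm \<Omega> f)\<^sup>2 + (\<Sum>k\<in>UNIV. (L2_norm \<Omega> (weak_pderiv \<Omega> k f))\<^sup>2))"

definition W1_0 :: "(real ^ 'n) set \<Rightarrow> 'n::finite cfun set" where
  "W1_0 \<Omega> = {f \<in> W1 \<Omega>. \<forall>e>0. \<exists>\<phi>\<in>test_funs \<Omega>. W1_norm \<Omega> (\<lambda>x. f x - \<phi> x) < e}"

definition weighted_grad ::
  "(real ^ 'n) set \<Rightarrow> (real ^ 'n \<Rightarrow> real) \<Rightarrow> 'n::finite cfun \<Rightarrow> 'n \<Rightarrow> 'n cfun" where
  "weighted_grad \<Omega> p u = (\<lambda>k x. complex_of_real (1 / p x) * weak_grad \<Omega> u k x)"

definition diffusion_graph ::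
  "(real ^ 'n) set \<Rightarrow> (real ^ 'n \<Rightarrow> real) \<Rightarrow> ('n::finite cfun \<times> 'n cfun) set" where
  "diffusion_graph \<Omega> p =
     {(u, f). u \<in> W1_0 \<Omega> \<and> (weighted_grad \<Omega> p u, f) \<in> grad_adjoint_graph \<Omega>}"

definition diffusion_inverse ::
  "(real ^ 'n) set \<Rightarrow> (real ^ 'n \<Rightarrow> real) \<Rightarrow> 'n::finite cfun \<Rightarrow> 'n cfun" where
  "diffusion_inverse \<Omega> p = op_apply ((diffusion_graph \<Omega> p)\<inverse>)"

end

theory Submission
  imports Defs
begin

text \<open>
  Write \<open>w\<close> for the reciprocal of a coefficient.  A function \<open>u\<close> in \<open>W1_0 \<Omega>\<close> satisfies
  \<open>A u = f\<close> exactly if the weak equation \<open>\<langle>w \<nabla>u, \<nabla>\<psi>\<rangle> = \<langle>f, \<psi>\<rangle>\<close> holds for all test functions \<open>\<psi>\<close>,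
  and by density then for all \<open>\<psi>\<close> in \<open>W1_0 \<Omega>\<close>.  Let \<open>u\<close> and \<open>u'\<close> solve it for the weights \<open>w\<close> and
  \<open>w'\<close> with the same \<open>f\<close>.  Subtracting the equations and inserting \<open>\<psi> = u' - u\<close> gives
  \<open>\<langle>w' \<nabla>(u' - u), \<nabla>(u' - u)\<rangle> = \<langle>(w - w') \<nabla>u, \<nabla>(u' - u)\<rangle>\<close>, so that a lower bound \<open>\<alpha>\<close> for \<open>w'\<close> yields
  \<open>\<alpha> \<parallel>\<nabla>(u' - u)\<parallel> \<le> \<parallel>(w' - w) \<nabla>u\<parallel>\<close>, see \<open>weak_solution_stability\<close>.  The gradient on the right belongs to
  the solution for \<open>w\<close>.  If \<open>w\<close> is the limiting weight, this gradient is a fixed square-integrable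
  field, and dominated convergence sends the right-hand side to zero when \<open>w'\<close> runs through a
  uniformly bounded sequence that converges to \<open>w\<close> almost everywhere.  The uniform upper bound of the
  coefficients provides a common \<open>\<alpha>\<close>, their uniform lower bound \<open>\<epsilon>\<close> provides the dominating
  function.  The Poincare inequality then gives convergence of the solutions themselves, and
  \<open>w' \<nabla>u' - w \<nabla>u = w' \<nabla>(u' - u) + (w' - w) \<nabla>u\<close> gives convergence of the fluxes; this is
  \<open>weak_solutions_converge\<close>.

  The inverse operators are defined by choosing a preimage, so the argument applies only once
  every \<open>f\<close> is known to have one.  It is obtained in \<open>weak_solution_exists\<close> from a minimizing sequence of the
  Dirichlet functional over the test functions, which converges because \<open>L2\<close> is complete
  (\<open>L2_complete\<close>).  Likewise, a weak derivative is a chosen representative, and everything said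
  about it depends on its uniqueness up to null sets.  This is the fundamental lemma of the calculus
  of variations (\<open>L2_zero_of_orthogonal_test_funs\<close>), for which smooth bump functions are constructed
  from \<open>exp (- 1/t)\<close>.  Finally, that test functions are weakly differentiable is integration by
  parts, which follows from the translation invariance of the integral (\<open>integral_pderiv_k_eq_0\<close>).
\<close>

section \<open>The space of square-integrable functions\<close>

lemma L2_measurable: "f \<in> L2 \<Omega> \<Longrightarrow> f \<in> borel_measurable (lebesgue_on \<Omega>)"
  by (simp add: L2_def)

lemma L2_integrable: "f \<in> L2 \<Omega> \<Longrightarrow> integrable (lebesgue_on \<Omega>) (\<lambda>x. (cmod (f x))\<^sup>2)"
  by (simp add: L2_def)

lemma L2_norm_nonneg [simp]: "0 \<le> L2_norm \<Omega> f"
  by (simp add: L2_norm_def)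

lemma L2_norm_power2: "(L2_norm \<Omega> f)\<^sup>2 = (LINT x|lebesgue_on \<Omega>. (cmod (f x))\<^sup>2)"
  by (simp add: L2_norm_def)

lemma cmod_add_power2_le: "(cmod (a + b))\<^sup>2 \<le> 2 * (cmod a)\<^sup>2 + 2 * (cmod b)\<^sup>2"
proof -
  have "(cmod (a + b))\<^sup>2 \<le> (cmod a + cmod b)\<^sup>2"
    by (intro power_mono norm_triangle_ineq) auto
  also have "\<dots> \<le> 2 * (cmod a)\<^sup>2 + 2 * (cmod b)\<^sup>2"
    using sum_squares_bound[of "cmod a" "cmod b"] by (simp add: power2_sum)
  finally show ?thesis .
qed

lemma L2_add:
  assumes "f \<in> L2 \<Omega>" "g \<in> L2 \<Omega>"
  shows "(\<lambda>x. f x + g x) \<in> L2 \<Omega>"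
proof -
  note [measurable] = assms[THEN L2_measurable]
  have "integrable (lebesgue_on \<Omega>) (\<lambda>x. (cmod (f x + g x))\<^sup>2)"
  proof (rule Bochner_Integration.integrable_bound)
    show "integrable (lebesgue_on \<Omega>) (\<lambda>x. 2 * (cmod (f x))\<^sup>2 + 2 * (cmod (g x))\<^sup>2)"
      using assms by (intro Bochner_Integration.integrable_add integrable_mult_right L2_integrable)
    show "AE x in lebesgue_on \<Omega>. norm ((cmod (f x + g x))\<^sup>2)
        \<le> norm (2 * (cmod (f x))\<^sup>2 + 2 * (cmod (g x))\<^sup>2)"
      using cmod_add_power2_le by (intro AE_I2) simp
  qed measurable
  then show ?thesis by (simp add: L2_def)
qed

lemma L2_mult_bounded:
  fixes a :: "real ^ 'n::finite \<Rightarrow> complex"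
  assumes f: "f \<in> L2 \<Omega>" and a: "a \<in> borel_measurable (lebesgue_on \<Omega>)"
    and bd: "AE x in lebesgue_on \<Omega>. cmod (a x) \<le> K"
  shows "(\<lambda>x. a x * f x) \<in> L2 \<Omega>"
proof -
  note [measurable] = f[THEN L2_measurable] a
  have "integrable (lebesgue_on \<Omega>) (\<lambda>x. (cmod (a x * f x))\<^sup>2)"
  proof (rule Bochner_Integration.integrable_bound)
    show "integrable (lebesgue_on \<Omega>) (\<lambda>x. K\<^sup>2 * (cmod (f x))\<^sup>2)"
      using f by (intro integrable_mult_right L2_integrable)
    show "AE x in lebesgue_on \<Omega>. norm ((cmod (a x * f x))\<^sup>2) \<le> norm (K\<^sup>2 * (cmod (f x))\<^sup>2)"
      using bd by eventually_elim (auto simp: norm_mult power_mult_distrib intro!: mult_right_mono power_mono)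
  qed measurable
  then show ?thesis by (simp add: L2_def)
qed

lemma L2_scale: "f \<in> L2 \<Omega> \<Longrightarrow> (\<lambda>x. c * f x) \<in> L2 \<Omega>"
  by (rule L2_mult_bounded[where K = "cmod c"]) auto

lemma L2_diff: "f \<in> L2 \<Omega> \<Longrightarrow> g \<in> L2 \<Omega> \<Longrightarrow> (\<lambda>x. f x - g x) \<in> L2 \<Omega>"
  using L2_add[of f \<Omega> "\<lambda>x. (-1) * g x"] L2_scale[of g \<Omega> "-1"] by simp

lemma L2_norm_scale: "L2_norm \<Omega> (\<lambda>x. c * f x) = cmod c * L2_norm \<Omega> f"
  by (simp add: L2_norm_def norm_mult power_mult_distrib real_sqrt_mult)

lemma L2_norm_diff_commute: "L2_norm \<Omega> (\<lambda>x. f x - g x) = L2_norm \<Omega> (\<lambda>x. g x - f x)"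
  by (simp add: L2_norm_def norm_minus_commute)

lemma L2_norm_cong_AE:
  assumes "f \<in> L2 \<Omega>" "g \<in> L2 \<Omega>" "AE x in lebesgue_on \<Omega>. f x = g x"
  shows "L2_norm \<Omega> f = L2_norm \<Omega> g"
proof -
  note [measurable] = assms(1,2)[THEN L2_measurable]
  have "(LINT x|lebesgue_on \<Omega>. (cmod (f x))\<^sup>2) = (LINT x|lebesgue_on \<Omega>. (cmod (g x))\<^sup>2)"
    using assms(3) by (intro integral_cong_AE) (auto elim: eventually_mono)
  then show ?thesis by (simp add: L2_norm_def)
qed

lemma L2_norm_mult_bounded:
  fixes a :: "real ^ 'n::finite \<Rightarrow> complex"
  assumes f: "f \<in> L2 \<Omega>" and a: "a \<in> borel_measurable (lebesgue_on \<Omega>)"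
    and bd: "AE x in lebesgue_on \<Omega>. cmod (a x) \<le> K" and K: "0 \<le> K"
  shows "L2_norm \<Omega> (\<lambda>x. a x * f x) \<le> K * L2_norm \<Omega> f"
proof -
  have "(LINT x|lebesgue_on \<Omega>. (cmod (a x * f x))\<^sup>2) \<le> (LINT x|lebesgue_on \<Omega>. K\<^sup>2 * (cmod (f x))\<^sup>2)"
  proof (intro integral_mono_AE L2_integrable L2_mult_bounded[OF f a bd] integrable_mult_right f)
    show "AE x in lebesgue_on \<Omega>. (cmod (a x * f x))\<^sup>2 \<le> K\<^sup>2 * (cmod (f x))\<^sup>2"
      using bd
    proof eventually_elim
      case (elim x)
      show ?case unfolding norm_mult power_mult_distrib
        by (intro mult_right_mono power_mono elim) auto
    qed
  qed
  also have "\<dots> = (K * L2_norm \<Omega> f)\<^sup>2"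
    by (simp add: power_mult_distrib L2_norm_power2)
  finally have "(L2_norm \<Omega> (\<lambda>x. a x * f x))\<^sup>2 \<le> (K * L2_norm \<Omega> f)\<^sup>2"
    by (simp add: L2_norm_power2)
  then show ?thesis by (rule power2_le_imp_le) (use K in simp)
qed

lemma L2_inner_integrable:
  assumes "f \<in> L2 \<Omega>" "g \<in> L2 \<Omega>"
  shows "integrable (lebesgue_on \<Omega>) (\<lambda>x. cnj (f x) * g x)"
proof (rule Bochner_Integration.integrable_bound)
  note [measurable] = assms[THEN L2_measurable]
  show "integrable (lebesgue_on \<Omega>) (\<lambda>x. (cmod (f x))\<^sup>2 + (cmod (g x))\<^sup>2)"
    using assms by (intro Bochner_Integration.integrable_add L2_integrable)
  show "AE x in lebesgue_on \<Omega>. norm (cnj (f x) * g x) \<le> norm ((cmod (f x))\<^sup>2 + (cmod (g x))\<^sup>2)"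
  proof (intro AE_I2)
    fix x
    have "2 * cmod (f x) * cmod (g x) \<le> (cmod (f x))\<^sup>2 + (cmod (g x))\<^sup>2"
      by (rule sum_squares_bound)
    moreover have "0 \<le> cmod (f x) * cmod (g x)" by simp
    ultimately have "cmod (f x) * cmod (g x) \<le> (cmod (f x))\<^sup>2 + (cmod (g x))\<^sup>2"
      by linarith
    then show "norm (cnj (f x) * g x) \<le> norm ((cmod (f x))\<^sup>2 + (cmod (g x))\<^sup>2)"
      by (simp add: norm_mult)
  qed
  show "(\<lambda>x. cnj (f x) * g x) \<in> borel_measurable (lebesgue_on \<Omega>)" 
    by (intro borel_measurable_times borel_measurable_continuous_on[OF _ L2_measurable] assms L2_measurable continuous_intros)
qed

lemma L2_inner_commute: "L2_inner \<Omega> g f = cnj (L2_inner \<Omega> f g)"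
  unfolding L2_inner_def Bochner_Integration.integral_cnj[symmetric]
    complex_cnj_mult complex_cnj_cnj by (simp only: mult.commute)

lemma L2_inner_add_right:
  assumes "f \<in> L2 \<Omega>" "g \<in> L2 \<Omega>" "h \<in> L2 \<Omega>"
  shows "L2_inner \<Omega> f (\<lambda>x. g x + h x) = L2_inner \<Omega> f g + L2_inner \<Omega> f h"
  unfolding L2_inner_def distrib_left
  by (intro Bochner_Integration.integral_add L2_inner_integrable assms)

lemma L2_inner_diff_right:
  assumes "f \<in> L2 \<Omega>" "g \<in> L2 \<Omega>" "h \<in> L2 \<Omega>"
  shows "L2_inner \<Omega> f (\<lambda>x. g x - h x) = L2_inner \<Omega> f g - L2_inner \<Omega> f h"
  unfolding L2_inner_def right_diff_distrib
  by (intro Bochner_Integration.integral_diff L2_inner_integrable assms)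

lemma L2_inner_scale_right: "L2_inner \<Omega> f (\<lambda>x. c * g x) = c * L2_inner \<Omega> f g"
  unfolding L2_inner_def by (simp add: mult.left_commute)

lemma L2_inner_add_left:
  assumes "f \<in> L2 \<Omega>" "g \<in> L2 \<Omega>" "h \<in> L2 \<Omega>"
  shows "L2_inner \<Omega> (\<lambda>x. g x + h x) f = L2_inner \<Omega> g f + L2_inner \<Omega> h f"
  using L2_inner_add_right[OF assms] by (metis L2_inner_commute complex_cnj_add)

lemma L2_inner_diff_left:
  assumes "f \<in> L2 \<Omega>" "g \<in> L2 \<Omega>" "h \<in> L2 \<Omega>"
  shows "L2_inner \<Omega> (\<lambda>x. g x - h x) f = L2_inner \<Omega> g f - L2_inner \<Omega> h f"
  using L2_inner_diff_right[OF assms] by (metis L2_inner_commute complex_cnj_diff)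

lemma L2_inner_scale_left: "L2_inner \<Omega> (\<lambda>x. c * g x) f = cnj c * L2_inner \<Omega> g f"
  using L2_inner_scale_right[of \<Omega> f c g] by (metis L2_inner_commute complex_cnj_mult)

lemma L2_inner_minus_left: "L2_inner \<Omega> (\<lambda>x. - g x) f = - L2_inner \<Omega> g f"
  using L2_inner_scale_left[of \<Omega> "-1" g f] by simp

lemma L2_inner_self: "L2_inner \<Omega> f f = of_real ((L2_norm \<Omega> f)\<^sup>2)"
proof -
  have "cnj z * z = complex_of_real ((cmod z)\<^sup>2)" for z
    by (subst complex_norm_square) (rule mult.commute)
  then show ?thesis
    unfolding L2_inner_def L2_norm_power2 by (simp only: integral_complex_of_real)
qed

lemma L2_inner_mult_real:
  "L2_inner \<Omega> (\<lambda>x. complex_of_real (a x) * f x) g = L2_inner \<Omega> f (\<lambda>x. complex_of_real (a x) * g x)"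
  unfolding L2_inner_def by (simp add: mult_ac)

lemma L2_norm_add_power2:
  assumes "f \<in> L2 \<Omega>" "g \<in> L2 \<Omega>"
  shows "(L2_norm \<Omega> (\<lambda>x. f x + g x))\<^sup>2
    = (L2_norm \<Omega> f)\<^sup>2 + 2 * Re (L2_inner \<Omega> f g) + (L2_norm \<Omega> g)\<^sup>2"
proof -
  have "complex_of_real ((L2_norm \<Omega> (\<lambda>x. f x + g x))\<^sup>2)
     = L2_inner \<Omega> f f + L2_inner \<Omega> f g + (L2_inner \<Omega> g f + L2_inner \<Omega> g g)"
    unfolding L2_inner_self[symmetric]
    by (simp add: L2_inner_add_left L2_inner_add_right L2_add assms)
  then have "Re (complex_of_real ((L2_norm \<Omega> (\<lambda>x. f x + g x))\<^sup>2)) = Re \<dots>"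
    by (rule arg_cong)
  moreover have "Re (L2_inner \<Omega> g f) = Re (L2_inner \<Omega> f g)"
    by (subst L2_inner_commute) simp
  ultimately show ?thesis by (simp add: L2_inner_self)
qed

lemma discriminant_le_of_nonneg:
  fixes a b c :: real
  assumes "\<And>t. 0 \<le> a * t\<^sup>2 + 2 * b * t + c" and a: "0 \<le> a"
  shows "b\<^sup>2 \<le> a * c"
proof (cases "a = 0")
  case True
  have "b = 0"
  proof (rule ccontr)
    assume "b \<noteq> 0"
    then show False using assms(1)[of "- (c + 1) / (2 * b)"] True by simp
  qed
  then show ?thesis using True by simp
next
  case False
  then have "0 \<le> a * (a * (- b / a)\<^sup>2 + 2 * b * (- b / a) + c)"
    using assms(1)[of "- b / a"] a by (intro mult_nonneg_nonneg) auto
  also have "\<dots> = a * c - b\<^sup>2" using False by (simp add: field_simps power2_eq_square)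
  finally show ?thesis by simp
qed

lemma L2_Cauchy_Schwarz_Re:
  assumes "f \<in> L2 \<Omega>" "g \<in> L2 \<Omega>"
  shows "\<bar>Re (L2_inner \<Omega> f g)\<bar> \<le> L2_norm \<Omega> f * L2_norm \<Omega> g"
proof -
  have "0 \<le> (L2_norm \<Omega> g)\<^sup>2 * t\<^sup>2 + 2 * Re (L2_inner \<Omega> f g) * t + (L2_norm \<Omega> f)\<^sup>2" for t
    using L2_norm_add_power2[OF assms(1) L2_scale[OF assms(2)], of "complex_of_real t"]
    by (simp add: L2_norm_scale L2_inner_scale_right power_mult_distrib algebra_simps)
      (metis zero_le_power2)
  then have "(Re (L2_inner \<Omega> f g))\<^sup>2 \<le> (L2_norm \<Omega> g)\<^sup>2 * (L2_norm \<Omega> f)\<^sup>2"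
    by (rule discriminant_le_of_nonneg) simp
  then have "\<bar>Re (L2_inner \<Omega> f g)\<bar>\<^sup>2 \<le> (L2_norm \<Omega> f * L2_norm \<Omega> g)\<^sup>2"
    by (simp add: power_mult_distrib mult.commute)
  then show ?thesis by (rule power2_le_imp_le) simp
qed

text \<open>
  The bound for the modulus follows from the bound for the real part: multiplying \<open>g\<close> by a
  unimodular constant makes the inner product equal to its modulus.
\<close>

lemma L2_Cauchy_Schwarz:
  assumes "f \<in> L2 \<Omega>" "g \<in> L2 \<Omega>"
  shows "cmod (L2_inner \<Omega> f g) \<le> L2_norm \<Omega> f * L2_norm \<Omega> g"
proof (cases "L2_inner \<Omega> f g = 0")
  case False
  define z where "z = L2_inner \<Omega> f g"
  define c where "c = cnj z / cmod z"
  have z: "z \<noteq> 0" using False by (simp add: z_def)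
  have c: "cmod c = 1" "c * z = cmod z"
    using z by (auto simp: c_def norm_divide complex_norm_square[symmetric] power2_eq_square mult.commute)
  have "\<bar>Re (L2_inner \<Omega> f (\<lambda>x. c * g x))\<bar> \<le> L2_norm \<Omega> f * L2_norm \<Omega> (\<lambda>x. c * g x)"
    using assms by (intro L2_Cauchy_Schwarz_Re L2_scale)
  then show ?thesis
    unfolding L2_inner_scale_right L2_norm_scale z_def[symmetric] c by simp
qed simp

lemma L2_norm_triangle:
  assumes "f \<in> L2 \<Omega>" "g \<in> L2 \<Omega>"
  shows "L2_norm \<Omega> (\<lambda>x. f x + g x) \<le> L2_norm \<Omega> f + L2_norm \<Omega> g"
proof (rule power2_le_imp_le)
  show "(L2_norm \<Omega> (\<lambda>x. f x + g x))\<^sup>2 \<le> (L2_norm \<Omega> f + L2_norm \<Omega> g)\<^sup>2"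
    using L2_norm_add_power2[OF assms] L2_Cauchy_Schwarz_Re[OF assms] by (simp add: power2_sum)
qed simp

lemma L2_inner_tendsto:
  assumes g: "g \<in> L2 \<Omega>" and F: "\<And>m. F m \<in> L2 \<Omega>" and f: "f \<in> L2 \<Omega>"
    and lim: "(\<lambda>m. L2_norm \<Omega> (\<lambda>x. F m x - f x)) \<longlonglongrightarrow> 0"
  shows "(\<lambda>m. L2_inner \<Omega> g (F m)) \<longlonglongrightarrow> L2_inner \<Omega> g f"
    and "(\<lambda>m. L2_inner \<Omega> (F m) g) \<longlonglongrightarrow> L2_inner \<Omega> f g"
proof -
  show *: "(\<lambda>m. L2_inner \<Omega> g (F m)) \<longlonglongrightarrow> L2_inner \<Omega> g f"
  proof (rule Lim_null[THEN iffD2], rule Lim_null_comparison)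
    show "\<forall>\<^sub>F m in sequentially. norm (L2_inner \<Omega> g (F m) - L2_inner \<Omega> g f)
        \<le> L2_norm \<Omega> g * L2_norm \<Omega> (\<lambda>x. F m x - f x)"
      using L2_Cauchy_Schwarz[OF g L2_diff[OF F f]]
      by (simp add: L2_inner_diff_right g F f)
    show "(\<lambda>m. L2_norm \<Omega> g * L2_norm \<Omega> (\<lambda>x. F m x - f x)) \<longlonglongrightarrow> 0"
      using tendsto_mult_right_zero[OF lim] .
  qed
  show "(\<lambda>m. L2_inner \<Omega> (F m) g) \<longlonglongrightarrow> L2_inner \<Omega> f g"
    using tendsto_cnj[OF *] by (simp only: L2_inner_commute[symmetric])
qed

lemma nn_integral_cmod_power2:
  "f \<in> L2 \<Omega> \<Longrightarrow> (\<integral>\<^sup>+x. ennreal ((cmod (f x))\<^sup>2) \<partial>lebesgue_on \<Omega>) = ennreal ((L2_norm \<Omega> f)\<^sup>2)"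
  unfolding L2_norm_power2 by (intro nn_integral_eq_integral L2_integrable) auto

text \<open>
  If consecutive distances are at most \<open>4\<close> to the power \<open>-k\<close>, then the sum of
  \<open>4 ^ k * \<bar>F (k + 1) x - F k x\<bar>\<^sup>2\<close> has finite integral and so is finite almost everywhere, which
  dominates the increments at almost every point by a geometric series.
\<close>

lemma rapid_L2_Cauchy_AE_convergent:
  assumes F: "\<And>k. F k \<in> L2 \<Omega>"
    and rapid: "\<And>k. L2_norm \<Omega> (\<lambda>x. F (Suc k) x - F k x) \<le> (1/4) ^ k"
  shows "AE x in lebesgue_on \<Omega>. convergent (\<lambda>k. F k x)"
proof -
  note [measurable] = F[THEN L2_measurable]
  define d where "d k x = F (Suc k) x - F k x" for k x
  have d: "d k \<in> L2 \<Omega>" for k unfolding d_def by (intro L2_diff F)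
  note [measurable] = d[THEN L2_measurable]
  have summand: "(\<integral>\<^sup>+x. ennreal (4 ^ k * (cmod (d k x))\<^sup>2) \<partial>lebesgue_on \<Omega>) \<le> ennreal ((1/4) ^ k)" for k
  proof -
    have "(\<integral>\<^sup>+x. ennreal (4 ^ k * (cmod (d k x))\<^sup>2) \<partial>lebesgue_on \<Omega>)
        = ennreal (4 ^ k) * (\<integral>\<^sup>+x. ennreal ((cmod (d k x))\<^sup>2) \<partial>lebesgue_on \<Omega>)"
      by (subst nn_integral_cmult[symmetric]) (auto simp: ennreal_mult)
    also have "\<dots> = ennreal (4 ^ k * (L2_norm \<Omega> (d k))\<^sup>2)"
      by (simp add: nn_integral_cmod_power2 d ennreal_mult)
    also have "\<dots> \<le> ennreal (4 ^ k * ((1/4) ^ k)\<^sup>2)"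
      using rapid[of k] by (intro ennreal_leI mult_left_mono power_mono) (auto simp: d_def[abs_def])
    also have "4 ^ k * ((1/4) ^ k)\<^sup>2 = (1/4 :: real) ^ k"
      unfolding power2_eq_square power_mult_distrib[symmetric] by simp
    finally show ?thesis .
  qed
  have "(\<integral>\<^sup>+x. (\<Sum>k. ennreal (4 ^ k * (cmod (d k x))\<^sup>2)) \<partial>lebesgue_on \<Omega>)
      = (\<Sum>k. \<integral>\<^sup>+x. ennreal (4 ^ k * (cmod (d k x))\<^sup>2) \<partial>lebesgue_on \<Omega>)"
    by (intro nn_integral_suminf) measurable
  also have "\<dots> \<le> (\<Sum>k. ennreal ((1/4) ^ k))"
    by (intro suminf_le summand) auto
  also have "\<dots> = ennreal (\<Sum>k. (1/4) ^ k)"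
    by (intro suminf_ennreal2) (auto intro: summable_geometric)
  also have "\<dots> < \<infinity>" by simp
  finally have "AE x in lebesgue_on \<Omega>. (\<Sum>k. ennreal (4 ^ k * (cmod (d k x))\<^sup>2)) \<noteq> \<infinity>"
    by (intro nn_integral_PInf_AE) auto
  then show ?thesis
  proof eventually_elim
    case (elim x)
    define S where "S = enn2real (\<Sum>k. ennreal (4 ^ k * (cmod (d k x))\<^sup>2))"
    have S: "(\<Sum>k. ennreal (4 ^ k * (cmod (d k x))\<^sup>2)) = ennreal S"
      using elim by (simp add: S_def less_top)
    have S0: "0 \<le> S" by (simp add: S_def)
    have bd: "cmod (d k x) \<le> sqrt S * (1/2) ^ k" for k
    proof (rule power2_le_imp_le)
      have "(\<Sum>j\<in>{k}. ennreal (4 ^ j * (cmod (d j x))\<^sup>2)) \<le> ennreal S"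
        unfolding S[symmetric] by (rule sum_le_suminf) auto
      then have "4 ^ k * (cmod (d k x))\<^sup>2 \<le> S" using S0 by simp
      then have "(cmod (d k x))\<^sup>2 \<le> S * (1/4) ^ k" by (simp add: power_divide pos_le_divide_eq mult.commute)
      also have "\<dots> = (sqrt S * (1/2) ^ k)\<^sup>2"
      proof -
        have "((1/2) ^ k)\<^sup>2 = (1/4 :: real) ^ k"
          unfolding power2_eq_square power_mult_distrib[symmetric] by simp
        then show ?thesis using S0 by (simp only: power_mult_distrib real_sqrt_pow2)
      qed
      finally show "(cmod (d k x))\<^sup>2 \<le> (sqrt S * (1/2) ^ k)\<^sup>2" .
    qed (use S0 in auto)
    have "summable (\<lambda>k. sqrt S * (1/2) ^ k)" by (intro summable_mult summable_geometric) simp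
    then have "summable (\<lambda>k. d k x)"
      by (rule summable_comparison_test') (rule bd)
    then have "(\<lambda>n. F 0 x + (\<Sum>k<n. d k x)) \<longlonglongrightarrow> F 0 x + (\<Sum>k. d k x)"
      by (intro tendsto_add tendsto_const summable_LIMSEQ)
    moreover have "F 0 x + (\<Sum>k<n. d k x) = F n x" for n
      by (induction n) (simp, simp add: d_def add.assoc[symmetric])
    ultimately show ?case by (auto simp: convergent_def)
  qed
qed

text \<open>
  Along a subsequence the Cauchy sequence converges almost everywhere; the pointwise limit is the
  limit in the norm.  The index of the subsequence is a partial sum of the moduli of convergence
  \<open>N k\<close>, which is the simplest monotone function above all of them.
\<close>

theorem L2_complete:
  assumes F: "\<And>m. F m \<in> L2 \<Omega>"
    and Cauchy: "\<And>e. 0 < e \<Longrightarrow> \<exists>N. \<forall>m\<ge>N. \<forall>l\<ge>N. L2_norm \<Omega> (\<lambda>x. F m x - F l x) \<le> e"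
  obtains f where "f \<in> L2 \<Omega>" "(\<lambda>m. L2_norm \<Omega> (\<lambda>x. F m x - f x)) \<longlonglongrightarrow> 0"
proof -
  note [measurable] = F[THEN L2_measurable]
  have "\<exists>N. \<forall>k. \<forall>m\<ge>N k. \<forall>l\<ge>N k. L2_norm \<Omega> (\<lambda>x. F m x - F l x) \<le> (1/4) ^ k"
    using Cauchy by (intro choice) auto
  then obtain N where N: "\<And>k m l. N k \<le> m \<Longrightarrow> N k \<le> l \<Longrightarrow> L2_norm \<Omega> (\<lambda>x. F m x - F l x) \<le> (1/4) ^ k"
    by blast
  define r where "r k = (\<Sum>i\<le>k. N i)" for k
  have r: "N k \<le> r l" if "k \<le> l" for k l
    using that member_le_sum[of k "{..l}" N] by (simp add: r_def)
  define f where "f x = lim (\<lambda>k. F (r k) x)" for x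
  have [measurable]: "f \<in> borel_measurable (lebesgue_on \<Omega>)"
    unfolding f_def by (intro borel_measurable_lim_metric) measurable
  have "AE x in lebesgue_on \<Omega>. convergent (\<lambda>k. F (r k) x)"
    by (rule rapid_L2_Cauchy_AE_convergent) (auto intro!: F N r)
  then have conv: "AE x in lebesgue_on \<Omega>. (\<lambda>k. F (r k) x) \<longlonglongrightarrow> f x"
    by (simp add: f_def convergent_LIMSEQ_iff)
  \<comment> \<open>Fatou's lemma carries the Cauchy estimate over to the limit function.\<close>
  have bound: "(\<integral>\<^sup>+x. ennreal ((cmod (F m x - f x))\<^sup>2) \<partial>lebesgue_on \<Omega>) \<le> ennreal (((1/4) ^ k)\<^sup>2)"
    if m: "N k \<le> m" for m k
  proof -
    have "(\<integral>\<^sup>+x. ennreal ((cmod (F m x - f x))\<^sup>2) \<partial>lebesgue_on \<Omega>)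
        = (\<integral>\<^sup>+x. liminf (\<lambda>l. ennreal ((cmod (F m x - F (r l) x))\<^sup>2)) \<partial>lebesgue_on \<Omega>)"
      using conv
    proof (intro nn_integral_cong_AE, eventually_elim)
      case (elim x)
      have "(\<lambda>l. ennreal ((cmod (F m x - F (r l) x))\<^sup>2)) \<longlonglongrightarrow> ennreal ((cmod (F m x - f x))\<^sup>2)"
        by (intro tendsto_ennrealI tendsto_power tendsto_norm tendsto_diff tendsto_const elim)
      then show ?case by (rule lim_imp_Liminf[OF sequentially_bot, symmetric])
    qed
    also have "\<dots> \<le> liminf (\<lambda>l. \<integral>\<^sup>+x. ennreal ((cmod (F m x - F (r l) x))\<^sup>2) \<partial>lebesgue_on \<Omega>)"
      by (intro nn_integral_liminf) measurable
    also have "\<dots> \<le> liminf (\<lambda>l::nat. ennreal (((1/4) ^ k)\<^sup>2))"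
    proof (intro Liminf_mono eventually_sequentiallyI)
      fix l assume "k \<le> l"
      then have "L2_norm \<Omega> (\<lambda>x. F m x - F (r l) x) \<le> (1/4) ^ k" using m r by (intro N) auto
      then have "(L2_norm \<Omega> (\<lambda>x. F m x - F (r l) x))\<^sup>2 \<le> ((1/4) ^ k)\<^sup>2"
        by (intro power_mono) auto
      then show "(\<integral>\<^sup>+x. ennreal ((cmod (F m x - F (r l) x))\<^sup>2) \<partial>lebesgue_on \<Omega>) \<le> ennreal (((1/4) ^ k)\<^sup>2)"
        by (simp add: nn_integral_cmod_power2 L2_diff F ennreal_leI)
    qed
    also have "\<dots> = ennreal (((1/4) ^ k)\<^sup>2)" by (simp add: Liminf_const)
    finally show ?thesis .
  qed
  have diff_L2: "(\<lambda>x. F m x - f x) \<in> L2 \<Omega>" if "N k \<le> m" for m k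
  proof -
    have "integrable (lebesgue_on \<Omega>) (\<lambda>x. (cmod (F m x - f x))\<^sup>2)"
      using bound[OF that] by (intro integrableI_bounded) (auto intro: le_less_trans)
    then show ?thesis by (simp add: L2_def)
  qed
  have f: "f \<in> L2 \<Omega>"
    using L2_diff[OF F[of "N 0"] diff_L2[of 0 "N 0"]] by simp
  have norm_le: "L2_norm \<Omega> (\<lambda>x. F m x - f x) \<le> (1/4) ^ k" if "N k \<le> m" for m k
  proof (rule power2_le_imp_le)
    show "(L2_norm \<Omega> (\<lambda>x. F m x - f x))\<^sup>2 \<le> ((1/4) ^ k)\<^sup>2"
      using bound[OF that] by (simp add: nn_integral_cmod_power2 diff_L2[OF that])
  qed simp
  have "(\<lambda>m. L2_norm \<Omega> (\<lambda>x. F m x - f x)) \<longlonglongrightarrow> 0"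
  proof (rule LIMSEQ_I)
    fix e :: real assume "0 < e"
    then obtain k where "(1/4 :: real) ^ k < e" using real_arch_pow_inv[of e "1/4"] by auto
    then show "\<exists>no. \<forall>m\<ge>no. norm (L2_norm \<Omega> (\<lambda>x. F m x - f x) - 0) < e"
      using norm_le[of k] by (auto intro!: exI[of _ "N k"] intro: le_less_trans)
  qed
  with f show ?thesis by (rule that)
qed

section \<open>Smooth functions and bumps\<close>

lemma pderiv_k_eqI: "(f has_derivative f') (at x) \<Longrightarrow> pderiv_k k f x = f' (axis k 1)"
  unfolding pderiv_k_def using frechet_derivative_at by metis

lemma C_k_Suc_differentiable: "C_k (Suc m) f \<Longrightarrow> f differentiable (at x)"
  by simp

lemma C_k_continuous: "C_k m f \<Longrightarrow> continuous_on UNIV f"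
  by (cases m)
    (auto intro!: differentiable_imp_continuous_on simp: differentiable_on_def
      intro: differentiable_at_withinI)

lemma C_k_Suc_imp: "C_k (Suc m) f \<Longrightarrow> C_k m f"
proof (induction m arbitrary: f)
  case 0
  then show ?case using C_k_continuous[of "Suc 0" f] by simp
next
  case (Suc m)
  then have "\<And>k. C_k (Suc m) (pderiv_k k f)" by (subst (asm) C_k.simps(2)) blast
  then have "C_k m (pderiv_k k f)" for k by (intro Suc.IH)
  moreover have "f differentiable (at x)" for x using Suc.prems by simp
  ultimately show ?case by simp
qed

lemma pderiv_k_add:
  assumes "f differentiable (at x)" "g differentiable (at x)"
  shows "pderiv_k k (\<lambda>x. f x + g x) x = pderiv_k k f x + pderiv_k k g x"
proof -
  have "((\<lambda>x. f x + g x) has_derivative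
      (\<lambda>h. frechet_derivative f (at x) h + frechet_derivative g (at x) h)) (at x)"
    using assms by (intro has_derivative_add) (simp_all add: frechet_derivative_works)
  then show ?thesis by (subst pderiv_k_eqI) (auto simp: pderiv_k_def)
qed

lemma pderiv_k_mult:
  assumes "f differentiable (at x)" "g differentiable (at x)"
  shows "pderiv_k k (\<lambda>x. f x * g x) x = f x * pderiv_k k g x + pderiv_k k f x * g x"
proof -
  have "((\<lambda>x. f x * g x) has_derivative
      (\<lambda>h. f x * frechet_derivative g (at x) h + frechet_derivative f (at x) h * g x)) (at x)"
    using assms by (intro has_derivative_mult) (simp_all add: frechet_derivative_works)
  then show ?thesis by (subst pderiv_k_eqI) (auto simp: pderiv_k_def)
qed

lemma pderiv_k_const: "pderiv_k k (\<lambda>x. c) = (\<lambda>x. 0)"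
  by (intro ext) (auto simp: pderiv_k_def)

lemma pderiv_k_cmult: "f differentiable (at x) \<Longrightarrow> pderiv_k k (\<lambda>x. c * f x) x = c * pderiv_k k f x"
  by (subst pderiv_k_mult) (auto simp: pderiv_k_const)

lemma pderiv_k_cnj:
  assumes "f differentiable (at x)"
  shows "pderiv_k k (\<lambda>x. cnj (f x)) x = cnj (pderiv_k k f x)"
proof -
  have "((\<lambda>x. cnj (f x)) has_derivative (\<lambda>h. cnj (frechet_derivative f (at x) h))) (at x)"
    using assms by (intro bounded_linear.has_derivative[OF bounded_linear_cnj])
      (simp add: frechet_derivative_works)
  then show ?thesis by (subst pderiv_k_eqI) (auto simp: pderiv_k_def)
qed

lemma C_k_const: "C_k m (\<lambda>x. c)"
  by (induction m arbitrary: c) (simp_all add: pderiv_k_const)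

lemma C_k_add: "C_k m f \<Longrightarrow> C_k m g \<Longrightarrow> C_k m (\<lambda>x. f x + g x)"
proof (induction m arbitrary: f g)
  case 0
  then show ?case by (auto intro: continuous_on_add)
next
  case (Suc m)
  then have "pderiv_k k (\<lambda>x. f x + g x) = (\<lambda>x. pderiv_k k f x + pderiv_k k g x)" for k
    by (intro ext pderiv_k_add) auto
  with Suc show ?case by (auto intro: differentiable_add)
qed

lemma C_k_mult: "C_k m f \<Longrightarrow> C_k m g \<Longrightarrow> C_k m (\<lambda>x. f x * g x)"
proof (induction m arbitrary: f g)
  case 0
  then show ?case by (auto intro: continuous_on_mult)
next
  case (Suc m)
  then have eq: "pderiv_k k (\<lambda>x. f x * g x) = (\<lambda>x. f x * pderiv_k k g x + pderiv_k k f x * g x)" for k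
    by (intro ext pderiv_k_mult) auto
  have "C_k m f" "C_k m g" using Suc.prems by (auto intro: C_k_Suc_imp simp del: C_k.simps)
  moreover have "C_k m (pderiv_k k f)" "C_k m (pderiv_k k g)" for k using Suc.prems by auto
  ultimately have "C_k m (\<lambda>x. f x * pderiv_k k g x + pderiv_k k f x * g x)" for k
    by (intro C_k_add Suc.IH) auto
  with Suc.prems show ?case by (auto simp: eq)
qed

lemma C_k_cmult: "C_k m f \<Longrightarrow> C_k m (\<lambda>x. c * f x)"
  by (intro C_k_mult C_k_const)

lemma C_k_prod: "(\<And>i. i \<in> I \<Longrightarrow> C_k m (f i)) \<Longrightarrow> C_k m (\<lambda>x. \<Prod>i\<in>I. f i x)"
  by (induction I rule: infinite_finite_induct) (auto intro: C_k_const C_k_mult)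

text \<open>
  The functions \<open>P (1/t) * exp (- 1/t)\<close>, continued by zero to \<open>t \<le> 0\<close>, with \<open>P\<close> a polynomial.
  Differentiation maps this family to itself, which makes all its members smooth.
\<close>

definition flat_exp :: "real poly \<Rightarrow> real \<Rightarrow> real" where
  "flat_exp P t = (if 0 < t then poly P (1 / t) * exp (- (1 / t)) else 0)"

lemma poly_times_exp_minus_tendsto_0: "((\<lambda>s. poly P s * exp (- s)) \<longlongrightarrow> (0::real)) at_top"
proof -
  have "((\<lambda>s. \<Sum>i\<le>degree P. coeff P i * (s ^ i / exp s)) \<longlongrightarrow> (\<Sum>i\<le>degree P. coeff P i * 0)) at_top"
    by (intro tendsto_sum tendsto_mult tendsto_const tendsto_power_div_exp_0)
  then show ?thesis by (simp add: poly_altdef exp_minus sum_distrib_right divide_inverse mult.assoc)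
qed

text \<open>At the origin, the exponential factor beats every power of \<open>1/t\<close>.\<close>

lemma flat_exp_over_tendsto_0: "((\<lambda>h. flat_exp P h / h) \<longlongrightarrow> 0) (at 0)"
proof (rule filterlim_split_at)
  have "\<forall>\<^sub>F h in at_left (0::real). flat_exp P h / h = 0"
    by (auto simp: eventually_at_filter flat_exp_def)
  then show "((\<lambda>h. flat_exp P h / h) \<longlongrightarrow> 0) (at_left 0)"
    by (rule tendsto_eventually)
  have "\<forall>\<^sub>F s in at_top. poly (pCons 0 P) s * exp (- s) = flat_exp P (inverse s) / inverse s"
    using eventually_gt_at_top[of 0] by eventually_elim (simp add: flat_exp_def field_simps)
  then have "((\<lambda>s. flat_exp P (inverse s) / inverse s) \<longlongrightarrow> 0) at_top"
    using poly_times_exp_minus_tendsto_0[of "pCons 0 P"] by (rule Lim_transform_eventually[rotated])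
  then show "((\<lambda>h. flat_exp P h / h) \<longlongrightarrow> 0) (at_right 0)"
    by (simp add: filterlim_at_right_to_top)
qed

lemma flat_exp_deriv:
  "(flat_exp P has_real_derivative flat_exp ([:0, 0, 1:] * (P - pderiv P)) t) (at t)"
proof -
  consider "t < 0" | "t = 0" | "0 < t" by linarith
  then show ?thesis
  proof cases
    case 1
    have "((\<lambda>t. 0) has_real_derivative 0) (at t)" by simp
    then have "(flat_exp P has_real_derivative 0) (at t)"
      by (rule has_field_derivative_transform_within_open[where S = "{..<0}"])
        (use 1 in \<open>auto simp: flat_exp_def\<close>)
    then show ?thesis using 1 by (simp add: flat_exp_def)
  next
    case 2
    then show ?thesis
      using flat_exp_over_tendsto_0[of P] by (simp add: has_field_derivative_iff flat_exp_def)
  next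
    case 3
    have "((\<lambda>t. poly P (1 / t) * exp (- (1 / t))) has_real_derivative
        poly P (1 / t) * (exp (- (1 / t)) * (1 / t\<^sup>2)) + poly (pderiv P) (1 / t) * (- (1 / t\<^sup>2)) * exp (- (1 / t))) (at t)"
      using 3 by (auto intro!: derivative_eq_intros DERIV_chain2[OF poly_DERIV] simp: power2_eq_square)
    then have "(flat_exp P has_real_derivative
        poly P (1 / t) * (exp (- (1 / t)) * (1 / t\<^sup>2)) + poly (pderiv P) (1 / t) * (- (1 / t\<^sup>2)) * exp (- (1 / t))) (at t)"
      by (rule has_field_derivative_transform_within_open[where S = "{0<..}"])
        (use 3 in \<open>auto simp: flat_exp_def\<close>)
    then show ?thesis
      by (rule DERIV_cong) (use 3 in \<open>simp add: flat_exp_def power2_eq_square algebra_simps\<close>)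
  qed
qed

lemma flat_exp_coordinate_has_derivative:
  fixes k :: "'n::finite"
  shows "((\<lambda>x. complex_of_real (flat_exp P (c * x $ k + d))) has_derivative
    (\<lambda>h. of_real (c * h $ k) * of_real (flat_exp ([:0, 0, 1:] * (P - pderiv P)) (c * x $ k + d)))) (at x)"
proof -
  have "((\<lambda>x. c * x $ k + d) has_derivative (\<lambda>h. c * h $ k)) (at x)"
    using has_derivative_add[OF has_derivative_mult_right[OF
        bounded_linear_imp_has_derivative[OF bounded_linear_vec_nth]] has_derivative_const]
    by fastforce
  then have "((\<lambda>x. flat_exp P (c * x $ k + d)) has_derivative
     (\<lambda>h. (c * h $ k) * flat_exp ([:0, 0, 1:] * (P - pderiv P)) (c * x $ k + d))) (at x)"
    using has_derivative_compose flat_exp_deriv[of P "c * x $ k + d"]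
    unfolding has_field_derivative_def by (fastforce simp: mult.commute)
  then show ?thesis
    using bounded_linear.has_derivative[OF bounded_linear_of_real] by fastforce
qed

lemma C_k_flat_exp_coordinate: "C_k m (\<lambda>x. of_real (flat_exp P (c * x $ k + d)))"
proof (induction m arbitrary: P)
  case 0
  have "(\<lambda>x. complex_of_real (flat_exp P (c * x $ k + d))) differentiable_on UNIV"
    unfolding differentiable_on_def differentiable_def
    using flat_exp_coordinate_has_derivative by blast
  then show ?case unfolding C_k.simps by (rule differentiable_imp_continuous_on)
next
  case (Suc m)
  show ?case
    unfolding C_k.simps
  proof (intro conjI allI)
    show "(\<lambda>x. complex_of_real (flat_exp P (c * x $ k + d))) differentiable (at x)" for x
      unfolding differentiable_def using flat_exp_coordinate_has_derivative by blast
    fix j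
    have "pderiv_k j (\<lambda>x. complex_of_real (flat_exp P (c * x $ k + d)))
       = (\<lambda>x. of_real (c * axis j 1 $ k) * of_real (flat_exp ([:0, 0, 1:] * (P - pderiv P)) (c * x $ k + d)))"
      by (intro ext pderiv_k_eqI flat_exp_coordinate_has_derivative)
    then show "C_k m (pderiv_k j (\<lambda>x. complex_of_real (flat_exp P (c * x $ k + d))))"
      by (simp only:) (intro C_k_cmult Suc)
  qed
qed

text \<open>
  For sharpness \<open>s > 0\<close>, a smooth function that is positive exactly on the open box between \<open>a\<close>
  and \<open>b\<close>; it increases to the indicator of that box as \<open>s\<close> tends to infinity.
\<close>

definition box_bump :: "real ^ 'n \<Rightarrow> real ^ 'n \<Rightarrow> real \<Rightarrow> real ^ 'n::finite \<Rightarrow> real" where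
  "box_bump a b s x = (\<Prod>k\<in>UNIV. flat_exp 1 (s * (x $ k - a $ k)) * flat_exp 1 (s * (b $ k - x $ k)))"

lemma C_k_box_bump: "C_k m (\<lambda>x. complex_of_real (box_bump a b s x))"
proof -
  have "s * (x $ k - a $ k) = s * x $ k + - (s * a $ k)" "s * (b $ k - x $ k) = - s * x $ k + s * b $ k"
    for x :: "real ^ 'a" and k
    by (simp_all add: algebra_simps)
  then show ?thesis
    unfolding box_bump_def of_real_prod of_real_mult
    by (simp only:) (intro C_k_prod C_k_mult C_k_flat_exp_coordinate)
qed

lemma flat_exp_1_bounds: "0 \<le> flat_exp 1 t" "flat_exp 1 t \<le> 1"
  by (auto simp: flat_exp_def)

lemma box_bump_bounds: "0 \<le> box_bump a b s x" "box_bump a b s x \<le> 1"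
  unfolding box_bump_def
  by (intro prod_nonneg prod_le_1 mult_nonneg_nonneg conjI mult_le_one ballI flat_exp_1_bounds)+

lemma box_bump_nonzero_iff:
  assumes "0 < s"
  shows "box_bump a b s x \<noteq> 0 \<longleftrightarrow> x \<in> box a b"
  using assms unfolding box_bump_def by (auto simp: flat_exp_def mem_box_cart zero_less_mult_iff)

lemma box_bump_tendsto_indicator:
  "(\<lambda>m. box_bump a b (real (Suc m)) x) \<longlonglongrightarrow> indicator (box a b) x"
proof (cases "x \<in> box a b")
  case False
  then show ?thesis using box_bump_nonzero_iff[of "real (Suc _)" a b x] by auto
next
  case True
  have lim: "(\<lambda>m. flat_exp 1 (real (Suc m) * t)) \<longlonglongrightarrow> 1" if "0 < t" for t
  proof -
    have "(\<lambda>m. exp (- (inverse (real (Suc m)) * (1 / t)))) \<longlonglongrightarrow> exp (- (0 * (1 / t)))"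
      by (intro tendsto_intros LIMSEQ_inverse_real_of_nat)
    moreover have "flat_exp 1 (real (Suc m) * t) = exp (- (inverse (real (Suc m)) * (1 / t)))" for m
      using that by (simp add: flat_exp_def divide_inverse)
    ultimately show ?thesis by simp
  qed
  have "(\<lambda>m. box_bump a b (real (Suc m)) x) \<longlonglongrightarrow> (\<Prod>k\<in>(UNIV::'a set). 1 * 1)"
    unfolding box_bump_def using True by (intro tendsto_prod tendsto_mult lim) (auto simp: mem_box_cart)
  then show ?thesis using True by simp
qed

lemma box_bump_test_fun:
  assumes "cbox a b \<subseteq> \<Omega>" "0 < s"
  shows "(\<lambda>x. complex_of_real (box_bump a b s x)) \<in> test_funs \<Omega>"
proof -
  have supp: "{x. complex_of_real (box_bump a b s x) \<noteq> 0} = box a b"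
    using box_bump_nonzero_iff[OF assms(2)] by auto
  have "closure (box a b) \<subseteq> cbox a b"
    by (rule closure_minimal) (auto simp: box_subset_cbox)
  moreover from this have "compact (closure (box a b))"
    using compact_cbox[of a b] by (metis closed_closure compact_Int_closed inf.absorb2)
  ultimately show ?thesis
    unfolding test_funs_def mem_Collect_eq supp using assms(1) C_k_box_bump by blast
qed

section \<open>The fundamental lemma of the calculus of variations\<close>

lemma sigma_finite_lebesgue: "sigma_finite_measure (lebesgue :: 'a::euclidean_space measure)"
proof -
  obtain A :: "'a set set" where "countable A" "A \<subseteq> sets lborel" "\<Union>A = space lborel"
      "\<forall>a\<in>A. emeasure lborel a \<noteq> \<infinity>"
    using lborel.sigma_finite_countable by blast
  then show ?thesis by unfold_locales (intro exI[of _ A], auto simp: emeasure_completion)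
qed

text \<open>
  The sets over which \<open>h\<close> integrates to zero form a Dynkin system that contains the boxes, which
  are closed under intersection and generate the Borel sets; Lebesgue measurable sets differ from
  Borel sets by null sets.
\<close>

lemma AE_zero_of_box_integrals_zero:
  fixes h :: "'a::euclidean_space \<Rightarrow> 'b::{banach, second_countable_topology}"
  assumes int: "integrable lebesgue h"
    and box: "\<And>a b. (LINT x:box a b|lebesgue. h x) = 0"
    and total: "(LINT x|lebesgue. h x) = 0"
  shows "AE x in lebesgue. h x = 0"
proof -
  have set_int: "set_integrable lebesgue A h" if "A \<in> sets lebesgue" for A
    using integrable_mult_indicator[OF that int] by (simp add: set_integrable_def)
  have leb: "A \<in> sets lebesgue" if "A \<in> sigma_sets UNIV (range (\<lambda>(a, b). box a b))" for A :: "'a set"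
    using that borel_eq_box[where 'a = 'a] by (metis sets_completionI_sets sets_lborel sets_measure_of subset_UNIV top_greatest Pow_UNIV)
  have borel: "(LINT x:A|lebesgue. h x) = 0" if "A \<in> sigma_sets UNIV (range (\<lambda>(a, b). box a b))"
    for A :: "'a set"
  proof (rule sigma_sets_induct_disjoint[where P = "\<lambda>A. (LINT x:A|lebesgue. h x) = 0", OF _ _ that])
    show "Int_stable (range (\<lambda>(a, b). box a b :: 'a set))"
      by (auto simp: Int_stable_def box_Int_box)
    fix A :: "'a set"
    { assume "A \<in> range (\<lambda>(a, b). box a b)"
      then show "(LINT x:A|lebesgue. h x) = 0" using box by auto }
    { assume A: "A \<in> sigma_sets UNIV (range (\<lambda>(a, b). box a b))" and IH: "(LINT x:A|lebesgue. h x) = 0"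
      have "(LINT x:A \<union> (UNIV - A)|lebesgue. h x) = (LINT x:A|lebesgue. h x) + (LINT x:UNIV - A|lebesgue. h x)"
        using leb[OF A] by (intro set_integral_Un set_int) auto
      then show "(LINT x:UNIV - A|lebesgue. h x) = 0"
        using IH total by (simp add: set_lebesgue_integral_def) }
  next
    fix A :: "nat \<Rightarrow> 'a set"
    assume "disjoint_family A" and A: "range A \<subseteq> sigma_sets UNIV (range (\<lambda>(a, b). box a b))"
      and IH: "\<And>i. (LINT x:A i|lebesgue. h x) = 0"
    have A': "A i \<in> sets lebesgue" for i using A by (intro leb) auto
    have "(LINT x:(\<Union>i. A i)|lebesgue. h x) = (\<Sum>i. (LINT x:A i|lebesgue. h x))"
      using \<open>disjoint_family A\<close> A'
      by (intro lebesgue_integral_countable_add set_int) (auto simp: disjoint_family_on_def)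
    then show "(LINT x:(\<Union>i. A i)|lebesgue. h x) = 0" by (simp add: IH)
  qed (auto simp: set_lebesgue_integral_def)
  show ?thesis
  proof (rule sigma_finite_measure.density_unique_banach[OF _ int])
    fix A :: "'a set" assume A: "A \<in> sets lebesgue"
    then obtain S N N' where S: "A = S \<union> N" "N \<subseteq> N'" "N' \<in> null_sets lborel" "S \<in> sets borel"
      by (auto elim: sets_completionE)
    have "AE x in lebesgue. x \<notin> N'"
      using S(3) by (intro AE_completion AE_not_in)
    then have "AE x in lebesgue. indicator A x *\<^sub>R h x = indicator S x *\<^sub>R h x"
      by eventually_elim (use S in \<open>auto simp: indicator_def\<close>)
    moreover have "S \<in> sets lebesgue" using S(4) by auto
    ultimately have "(LINT x:A|lebesgue. h x) = (LINT x:S|lebesgue. h x)"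
      unfolding set_lebesgue_integral_def using A int
      by (intro integral_cong_AE borel_measurable_scaleR borel_measurable_indicator) auto
    also have "\<dots> = 0" using S(4) by (intro borel) (simp add: borel_eq_box)
    finally show "(LINT x:A|lebesgue. h x) = (LINT x:A|lebesgue. 0)" by (simp add: set_lebesgue_integral_def)
  qed (simp_all add: sigma_finite_lebesgue)
qed

text \<open>
  An open set is a countable union of open boxes whose closures it contains, by the Lindelof
  property, and countably many exceptional null sets form a null set.
\<close>

lemma AE_lebesgue_on_of_boxes:
  fixes \<Omega> :: "'a::euclidean_space set"
  assumes "open \<Omega>"
    and local: "\<And>a b. cbox a b \<subseteq> \<Omega> \<Longrightarrow> AE x in lebesgue. x \<in> box a b \<longrightarrow> P x"
  shows "AE x in lebesgue_on \<Omega>. P x"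
proof -
  define \<B> where "\<B> = {box a b | a b :: 'a. cbox a b \<subseteq> \<Omega>}"
  have "\<Union>\<B> = \<Omega>"
  proof
    show "\<Union>\<B> \<subseteq> \<Omega>" using box_subset_cbox by (fastforce simp: \<B>_def)
    show "\<Omega> \<subseteq> \<Union>\<B>"
    proof
      fix x assume "x \<in> \<Omega>"
      then obtain a b where "cbox a b \<subseteq> \<Omega>" "x \<in> box a b"
        using open_contains_cbox[OF \<open>open \<Omega>\<close>] by metis
      then show "x \<in> \<Union>\<B>" unfolding \<B>_def by auto
    qed
  qed
  moreover obtain \<F> where \<F>: "\<F> \<subseteq> \<B>" "countable \<F>" "\<Union>\<F> = \<Union>\<B>"
    using Lindelof[of \<B>] by (auto simp: \<B>_def open_box)
  moreover have "AE x in lebesgue. \<forall>B\<in>\<F>. x \<in> B \<longrightarrow> P x"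
    using \<F> local by (subst AE_ball_countable) (auto simp: \<B>_def)
  ultimately have "AE x in lebesgue. x \<in> \<Omega> \<longrightarrow> P x"
    by (auto elim!: eventually_mono)
  then show ?thesis using \<open>open \<Omega>\<close> by (subst AE_restrict_space_iff) auto
qed

text \<open>
  Bumps converge boundedly to the indicator of a box, so \<open>g\<close> integrates to zero over every box
  that lies in \<open>\<Omega>\<close> together with its boundary.
\<close>

theorem L2_zero_of_orthogonal_test_funs:
  fixes \<Omega> :: "(real ^ 'n::finite) set"
  assumes \<Omega>: "open \<Omega>" and g: "g \<in> L2 \<Omega>"
    and orth: "\<And>\<phi>. \<phi> \<in> test_funs \<Omega> \<Longrightarrow> L2_inner \<Omega> g \<phi> = 0"
  shows "AE x in lebesgue_on \<Omega>. g x = 0"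
proof (rule AE_lebesgue_on_of_boxes[OF \<Omega>])
  fix a b :: "real ^ 'n" assume ab: "cbox a b \<subseteq> \<Omega>"
  have [measurable]: "box c d \<in> sets lebesgue" for c d :: "real ^ 'n" by auto
  have \<Omega>_leb: "\<Omega> \<inter> space lebesgue \<in> sets lebesgue" using \<Omega> by auto
  note [measurable] = L2_measurable[OF g]
  define G where "G x = indicator (box a b) x *\<^sub>R cnj (g x)" for x
  have ind_L2: "(\<lambda>x. indicator (box a b) x) \<in> L2 \<Omega>"
  proof -
    have "integrable lebesgue (\<lambda>x. indicator (box a b) x :: real)"
      using lmeasurable_box[of a b] by (simp add: fmeasurable_def less_top)
    then have "integrable (lebesgue_on \<Omega>) (\<lambda>x. indicator (box a b) x :: real)"
      unfolding integrable_restrict_space[OF \<Omega>_leb]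
      by (intro integrable_mult_indicator) (use \<Omega> in auto)
    moreover have "(cmod (indicator (box a b) x))\<^sup>2 = indicator (box a b) x" for x
      by (simp add: indicator_def)
    ultimately have "integrable (lebesgue_on \<Omega>) (\<lambda>x. (cmod (indicator (box a b) x))\<^sup>2)"
      by (simp only:)
    then show ?thesis by (auto simp: L2_def intro!: measurable_restrict_space1)
  qed
  have int_on: "integrable (lebesgue_on \<Omega>) (\<lambda>x. cnj (g x) * indicator (box a b) x)"
    by (rule L2_inner_integrable[OF g ind_L2])
  have in_\<Omega>: "indicator \<Omega> x *\<^sub>R (cnj (g x) * indicator (box a b) x) = G x" for x
    using ab box_subset_cbox[of a b] by (auto simp: G_def indicator_def)
  have intG: "integrable lebesgue G"
    using int_on unfolding integrable_restrict_space[OF \<Omega>_leb] in_\<Omega> .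
  have zero: "(LINT x:box c d|lebesgue. G x) = 0" if cd: "box c d \<subseteq> box a b" "cbox c d \<subseteq> \<Omega>" for c d
  proof -
    have "(\<lambda>m. LINT x|lebesgue_on \<Omega>. cnj (g x) * of_real (box_bump c d (real (Suc m)) x))
       \<longlonglongrightarrow> (LINT x|lebesgue_on \<Omega>. cnj (g x) * of_real (indicator (box c d) x))"
    proof (rule integral_dominated_convergence[where w = "\<lambda>x. norm (cnj (g x) * indicator (box a b) x)"])
      show "integrable (lebesgue_on \<Omega>) (\<lambda>x. norm (cnj (g x) * indicator (box a b) x))"
        using int_on by (rule integrable_norm)
      have "(\<lambda>x. complex_of_real (box_bump c d (real (Suc m)) x)) \<in> borel_measurable borel" for m
        using C_k_continuous[OF C_k_box_bump[of 0]] by (intro borel_measurable_continuous_onI)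
      then have [measurable]: "(\<lambda>x. complex_of_real (box_bump c d (real (Suc m)) x)) \<in> borel_measurable (lebesgue_on \<Omega>)" for m
        by (intro measurable_restrict_space1 measurable_completion) simp
      have [measurable]: "(\<lambda>x. cnj (g x)) \<in> borel_measurable (lebesgue_on \<Omega>)"
        by (intro borel_measurable_continuous_on[OF _ L2_measurable[OF g]] continuous_intros)
      show "(\<lambda>x. cnj (g x) * of_real (box_bump c d (real (Suc m)) x)) \<in> borel_measurable (lebesgue_on \<Omega>)" for m
        by measurable
      have "(\<lambda>x. complex_of_real (indicator (box c d) x)) \<in> borel_measurable (lebesgue_on \<Omega>)"
        by (intro measurable_restrict_space1 borel_measurable_of_real borel_measurable_indicator) auto
      then show "(\<lambda>x. cnj (g x) * of_real (indicator (box c d) x)) \<in> borel_measurable (lebesgue_on \<Omega>)"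
        by measurable
      show "AE x in lebesgue_on \<Omega>. (\<lambda>m. cnj (g x) * of_real (box_bump c d (real (Suc m)) x))
          \<longlonglongrightarrow> cnj (g x) * of_real (indicator (box c d) x)"
        by (intro AE_I2 tendsto_mult tendsto_const tendsto_of_real box_bump_tendsto_indicator)
      show "AE x in lebesgue_on \<Omega>. norm (cnj (g x) * of_real (box_bump c d (real (Suc m)) x))
          \<le> norm (cnj (g x) * indicator (box a b) x)" for m
      proof (intro AE_I2)
        fix x
        show "norm (cnj (g x) * of_real (box_bump c d (real (Suc m)) x))
          \<le> norm (cnj (g x) * indicator (box a b) x)"
        proof (cases "x \<in> box c d")
          case True
          then have "indicator (box a b) x = (1 :: complex)" using cd by (auto simp: indicator_def)
          then show ?thesis using box_bump_bounds[of c d "real (Suc m)" x]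
            by (simp add: norm_mult mult_left_le)
        next
          case False
          then have "box_bump c d (real (Suc m)) x = 0" using box_bump_nonzero_iff[of "real (Suc m)"] by fastforce
          then show ?thesis by simp
        qed
      qed
    qed
    moreover have "(LINT x|lebesgue_on \<Omega>. cnj (g x) * of_real (box_bump c d (real (Suc m)) x)) = 0" for m
      using orth[OF box_bump_test_fun[OF cd(2), of "real (Suc m)"]] by (simp add: L2_inner_def)
    ultimately have "(LINT x|lebesgue_on \<Omega>. cnj (g x) * of_real (indicator (box c d) x)) = 0"
      by (simp add: LIMSEQ_const_iff)
    moreover have "indicator \<Omega> x *\<^sub>R (cnj (g x) * of_real (indicator (box c d) x))
        = indicator (box c d) x *\<^sub>R G x" for x
      using cd box_subset_cbox[of c d] by (auto simp: G_def indicator_def)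
    ultimately show ?thesis
      by (simp add: integral_restrict_space[OF \<Omega>_leb] set_lebesgue_integral_def)
  qed
  have "AE x in lebesgue. G x = 0"
  proof (rule AE_zero_of_box_integrals_zero[OF intG])
    fix c d :: "real ^ 'n"
    obtain c' d' where cd': "box c d \<inter> box a b = box c' d'" "cbox c d \<inter> cbox a b = cbox c' d'"
      by (rule that[OF box_Int_box Int_interval])
    have "(LINT x:box c d|lebesgue. G x) = (LINT x:box c' d'|lebesgue. G x)"
      unfolding set_lebesgue_integral_def cd'(1)[symmetric]
      by (intro Bochner_Integration.integral_cong refl) (auto simp: G_def indicator_def)
    also have "\<dots> = 0" using cd' ab by (intro zero) auto
    finally show "(LINT x:box c d|lebesgue. G x) = 0" .
  next
    have "(LINT x|lebesgue. G x) = (LINT x:box a b|lebesgue. G x)"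
      unfolding set_lebesgue_integral_def
      by (intro Bochner_Integration.integral_cong) (auto simp: G_def indicator_def)
    also have "\<dots> = 0" using ab by (intro zero) auto
    finally show "(LINT x|lebesgue. G x) = 0" .
  qed
  then show "AE x in lebesgue. x \<in> box a b \<longrightarrow> g x = 0"
    by (rule eventually_mono) (auto simp: G_def)
qed

section \<open>Test functions\<close>

lemma test_fun_C_k: "\<phi> \<in> test_funs \<Omega> \<Longrightarrow> C_k m \<phi>"
  by (simp add: test_funs_def)

lemma test_fun_differentiable: "\<phi> \<in> test_funs \<Omega> \<Longrightarrow> \<phi> differentiable (at x)"
  using C_k_Suc_differentiable test_fun_C_k by metis

lemma test_fun_support:
  assumes "\<phi> \<in> test_funs \<Omega>"
  obtains K where "compact K" "K \<subseteq> \<Omega>" "\<And>x. x \<notin> K \<Longrightarrow> \<phi> x = 0"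
proof (rule that)
  show "compact (closure {x. \<phi> x \<noteq> 0})" "closure {x. \<phi> x \<noteq> 0} \<subseteq> \<Omega>"
    using assms by (auto simp: test_funs_def)
  show "\<phi> x = 0" if "x \<notin> closure {x. \<phi> x \<noteq> 0}" for x
    using that closure_subset[of "{x. \<phi> x \<noteq> 0}"] by blast
qed

lemma test_funI:
  assumes "\<And>m. C_k m \<phi>" and K: "compact K" "K \<subseteq> \<Omega>" "\<And>x. x \<notin> K \<Longrightarrow> \<phi> x = 0"
  shows "\<phi> \<in> test_funs \<Omega>"
proof -
  have "closure {x. \<phi> x \<noteq> 0} \<subseteq> K"
    using K by (intro closure_minimal compact_imp_closed) auto
  moreover from this have "compact (closure {x. \<phi> x \<noteq> 0})"
    using K(1) by (metis closed_closure compact_Int_closed inf.absorb2)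
  ultimately show ?thesis unfolding test_funs_def using assms by blast
qed

lemma test_fun_zero: "(\<lambda>x. 0) \<in> test_funs \<Omega>"
  by (rule test_funI[where K = "{}"]) (auto intro: C_k_const)

lemma test_fun_add:
  assumes "\<phi> \<in> test_funs \<Omega>" "\<psi> \<in> test_funs \<Omega>"
  shows "(\<lambda>x. \<phi> x + \<psi> x) \<in> test_funs \<Omega>"
proof -
  obtain K L where "compact K" "K \<subseteq> \<Omega>" "\<And>x. x \<notin> K \<Longrightarrow> \<phi> x = 0"
    and "compact L" "L \<subseteq> \<Omega>" "\<And>x. x \<notin> L \<Longrightarrow> \<psi> x = 0"
    using assms by (metis test_fun_support)
  then show ?thesis
    by (intro test_funI[where K = "K \<union> L"] C_k_add test_fun_C_k[OF assms(1)] test_fun_C_k[OF assms(2)])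
      auto
qed

lemma test_fun_scale:
  assumes "\<phi> \<in> test_funs \<Omega>"
  shows "(\<lambda>x. c * \<phi> x) \<in> test_funs \<Omega>"
proof -
  obtain K where "compact K" "K \<subseteq> \<Omega>" "\<And>x. x \<notin> K \<Longrightarrow> \<phi> x = 0"
    using assms by (metis test_fun_support)
  then show ?thesis
    by (intro test_funI[where K = K] C_k_cmult test_fun_C_k[OF assms]) auto
qed

lemma test_fun_diff: "\<phi> \<in> test_funs \<Omega> \<Longrightarrow> \<psi> \<in> test_funs \<Omega> \<Longrightarrow> (\<lambda>x. \<phi> x - \<psi> x) \<in> test_funs \<Omega>"
  using test_fun_add[of \<phi> \<Omega> "\<lambda>x. (-1) * \<psi> x"] test_fun_scale[of \<psi> \<Omega> "-1"] by simp

lemma pderiv_k_zero_off_support: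
  assumes "compact K" "\<And>x. x \<notin> K \<Longrightarrow> \<phi> x = 0" "x \<notin> K"
  shows "pderiv_k k \<phi> x = 0"
proof -
  have "open (- K)" using assms(1) by (simp add: compact_imp_closed open_Compl)
  then have "(\<phi> has_derivative (\<lambda>h. 0)) (at x)"
    by (rule has_derivative_transform_within_open[OF has_derivative_const[of 0]]) (use assms in auto)
  then show ?thesis by (rule pderiv_k_eqI)
qed

lemma test_fun_pderiv:
  assumes "\<phi> \<in> test_funs \<Omega>"
  shows "pderiv_k k \<phi> \<in> test_funs \<Omega>"
proof -
  obtain K where K: "compact K" "K \<subseteq> \<Omega>" "\<And>x. x \<notin> K \<Longrightarrow> \<phi> x = 0"
    using assms by (metis test_fun_support)
  show ?thesis
  proof (rule test_funI[OF _ K(1,2)])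
    show "C_k m (pderiv_k k \<phi>)" for m using test_fun_C_k[OF assms, of "Suc m"] by simp
    show "pderiv_k k \<phi> x = 0" if "x \<notin> K" for x
      using pderiv_k_zero_off_support[OF K(1) K(3) that] .
  qed
qed

lemma pderiv_k_diff:
  assumes "f differentiable (at x)" "g differentiable (at x)"
  shows "pderiv_k k (\<lambda>x. f x - g x) x = pderiv_k k f x - pderiv_k k g x"
proof -
  have "((\<lambda>x. f x - g x) has_derivative
      (\<lambda>h. frechet_derivative f (at x) h - frechet_derivative g (at x) h)) (at x)"
    using assms by (intro has_derivative_diff) (simp_all add: frechet_derivative_works)
  then show ?thesis by (subst pderiv_k_eqI) (auto simp: pderiv_k_def)
qed

lemma pderiv_k_test_add:
  "\<phi> \<in> test_funs \<Omega> \<Longrightarrow> \<psi> \<in> test_funs \<Omega> \<Longrightarrow>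
    pderiv_k k (\<lambda>x. \<phi> x + \<psi> x) = (\<lambda>x. pderiv_k k \<phi> x + pderiv_k k \<psi> x)"
  by (intro ext pderiv_k_add test_fun_differentiable)

lemma pderiv_k_test_diff:
  "\<phi> \<in> test_funs \<Omega> \<Longrightarrow> \<psi> \<in> test_funs \<Omega> \<Longrightarrow>
    pderiv_k k (\<lambda>x. \<phi> x - \<psi> x) = (\<lambda>x. pderiv_k k \<phi> x - pderiv_k k \<psi> x)"
  by (intro ext pderiv_k_diff test_fun_differentiable)

lemma pderiv_k_test_scale:
  "\<phi> \<in> test_funs \<Omega> \<Longrightarrow> pderiv_k k (\<lambda>x. c * \<phi> x) = (\<lambda>x. c * pderiv_k k \<phi> x)"
  by (intro ext pderiv_k_cmult test_fun_differentiable)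

lemma continuous_compact_support_integrable:
  fixes f :: "'a::euclidean_space \<Rightarrow> 'b::{banach, second_countable_topology}"
  assumes "continuous_on UNIV f" "compact K" "\<And>x. x \<notin> K \<Longrightarrow> f x = 0"
  shows "integrable lborel f"
proof -
  have "integrable lborel (\<lambda>x. indicator K x *\<^sub>R f x)"
    by (intro borel_integrable_compact assms continuous_on_subset[OF assms(1)]) simp
  moreover have "indicator K x *\<^sub>R f x = f x" for x using assms(3) by (auto simp: indicator_def)
  ultimately show ?thesis by simp
qed

lemma test_fun_L2:
  assumes \<Omega>: "open \<Omega>" and \<phi>: "\<phi> \<in> test_funs \<Omega>"
  shows "\<phi> \<in> L2 \<Omega>"
proof -
  have cont: "continuous_on UNIV \<phi>" using C_k_continuous[OF test_fun_C_k[OF \<phi>, of 0]] .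
  obtain K where K: "compact K" "K \<subseteq> \<Omega>" "\<And>x. x \<notin> K \<Longrightarrow> \<phi> x = 0"
    using \<phi> by (metis test_fun_support)
  have "integrable lborel (\<lambda>x. (cmod (\<phi> x))\<^sup>2)"
    using K by (intro continuous_compact_support_integrable[where K = K] continuous_intros cont) auto
  then have "integrable lebesgue (\<lambda>x. (cmod (\<phi> x))\<^sup>2)"
    by (simp add: integrable_completion borel_measurable_integrable)
  then have "integrable (lebesgue_on \<Omega>) (\<lambda>x. (cmod (\<phi> x))\<^sup>2)"
    using \<Omega> by (subst integrable_restrict_space) (auto intro: integrable_mult_indicator simp del: real_scaleR_def)
  moreover have "\<phi> \<in> borel_measurable (lebesgue_on \<Omega>)"
    using borel_measurable_continuous_onI[OF cont]
    by (intro measurable_restrict_space1 measurable_completion) simp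
  ultimately show ?thesis by (simp add: L2_def)
qed

lemma C_k_cnj: "C_k m f \<Longrightarrow> C_k m (\<lambda>x. cnj (f x))"
proof (induction m arbitrary: f)
  case 0
  then show ?case by (auto intro: continuous_intros)
next
  case (Suc m)
  then have "pderiv_k k (\<lambda>x. cnj (f x)) = (\<lambda>x. cnj (pderiv_k k f x))" for k
    by (intro ext pderiv_k_cnj) auto
  moreover have "(\<lambda>x. cnj (f x)) differentiable (at x)" for x
  proof -
    have "(f has_derivative frechet_derivative f (at x)) (at x)"
      using Suc.prems by (simp add: frechet_derivative_works)
    then show ?thesis
      unfolding differentiable_def by (blast intro: bounded_linear.has_derivative[OF bounded_linear_cnj])
  qed
  ultimately show ?case using Suc by auto
qed

text \<open>
  The integral of a difference quotient vanishes by translation invariance, and the difference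
  quotients converge boundedly, on a common bounded set, to the partial derivative.
\<close>

lemma integral_pderiv_k_eq_0:
  fixes F :: "'n::finite cfun"
  assumes F: "C_k (Suc 0) F" and K: "compact K" "\<And>x. x \<notin> K \<Longrightarrow> F x = 0"
  shows "(LINT x|lborel. pderiv_k k F x) = 0"
proof -
  define e :: "real ^ 'n" where "e = axis k 1"
  define s where "s m = inverse (real (Suc m))" for m
  have s: "0 < s m" "s m \<le> 1" for m by (auto simp: s_def field_simps)
  have e: "norm e = 1" by (simp add: e_def norm_axis_1)
  have contF: "continuous_on UNIV F" using C_k_continuous[OF F] .
  have contD: "continuous_on UNIV (pderiv_k k F)" using F by simp
  have D0: "pderiv_k k F x = 0" if "x \<notin> K" for x
    using pderiv_k_zero_off_support[OF K that] .
  have der: "(F has_derivative frechet_derivative F (at x)) (at x)" for x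
    using F by (simp add: frechet_derivative_works)
  have line: "((\<lambda>t. F (x + t *\<^sub>R e)) has_derivative (\<lambda>h. h *\<^sub>R pderiv_k k F (x + t *\<^sub>R e))) (at t within S)"
    for x t S
  proof -
    have "((\<lambda>t. x + t *\<^sub>R e) has_derivative (\<lambda>h. h *\<^sub>R e)) (at t within S)"
      by (auto intro!: derivative_eq_intros)
    then have "((\<lambda>t. F (x + t *\<^sub>R e)) has_derivative (\<lambda>h. frechet_derivative F (at (x + t *\<^sub>R e)) (h *\<^sub>R e))) (at t within S)"
      by (rule has_derivative_compose[OF _ der])
    moreover have "frechet_derivative F (at y) (h *\<^sub>R e) = h *\<^sub>R pderiv_k k F y" for y h
      using linear_cmul[OF has_derivative_linear[OF der]] by (simp add: pderiv_k_def e_def)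
    ultimately show ?thesis by simp
  qed
  obtain B where B: "\<And>x. norm (pderiv_k k F x) \<le> B" and B0: "0 \<le> B"
  proof -
    have "bounded (pderiv_k k F ` K)"
      using compact_continuous_image[OF continuous_on_subset[OF contD] K(1)] compact_imp_bounded by auto
    then obtain B where "0 < B" "\<And>x. x \<in> K \<Longrightarrow> norm (pderiv_k k F x) \<le> B"
      by (auto simp: bounded_pos)
    then show ?thesis using D0 by (intro that[of B]) (metis less_imp_le norm_zero, simp)
  qed
  obtain R where R: "\<And>x. x \<in> K \<Longrightarrow> norm x \<le> R"
    using compact_imp_bounded[OF K(1)] by (auto simp: bounded_iff)
  have quot_bound: "norm (F (x + s m *\<^sub>R e) - F x) \<le> B * s m" for x m
  proof -
    have "norm (F (x + s m *\<^sub>R e) - F (x + 0 *\<^sub>R e)) \<le> B * norm (s m - 0)"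
    proof (rule differentiable_bound[OF convex_closed_interval[of 0 "s m"] line])
      show "onorm (\<lambda>h. h *\<^sub>R pderiv_k k F (x + t *\<^sub>R e)) \<le> B" for t
        using B by (intro onorm_le) (simp add: mult.commute[of B] mult_left_mono)
    qed (use s[of m] in auto)
    then show ?thesis using s[of m] by simp
  qed
  have "(\<lambda>m. LINT x|lborel. (F (x + s m *\<^sub>R e) - F x) /\<^sub>R s m) \<longlonglongrightarrow> (LINT x|lborel. pderiv_k k F x)"
  proof (rule integral_dominated_convergence[where w = "\<lambda>x. indicator (cball 0 (R + 1)) x *\<^sub>R B"])
    show "integrable lborel (\<lambda>x::real ^ 'n. indicator (cball 0 (R + 1)) x *\<^sub>R B)"
      by (intro borel_integrable_compact compact_cball continuous_intros)
    show "pderiv_k k F \<in> borel_measurable lborel" 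
      using borel_measurable_continuous_onI[OF contD] by simp
    have [measurable]: "F \<in> borel_measurable borel"
      using borel_measurable_continuous_onI[OF contF] by simp
    show "(\<lambda>x. (F (x + s m *\<^sub>R e) - F x) /\<^sub>R s m) \<in> borel_measurable lborel" for m by measurable
    show "AE x in lborel. (\<lambda>m. (F (x + s m *\<^sub>R e) - F x) /\<^sub>R s m) \<longlonglongrightarrow> pderiv_k k F x"
    proof (intro AE_I2)
      fix x
      have "((\<lambda>t. norm (F (x + t *\<^sub>R e) - F x - t *\<^sub>R pderiv_k k F x) / norm t) \<longlongrightarrow> 0) (at 0)"
        using line[of x 0 UNIV] by (simp add: has_derivative_iff_norm)
      moreover have "\<forall>\<^sub>F t in at (0::real). norm (F (x + t *\<^sub>R e) - F x - t *\<^sub>R pderiv_k k F x) / norm t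
          = norm ((F (x + t *\<^sub>R e) - F x) /\<^sub>R t - pderiv_k k F x)"
      proof (intro eventually_at_filter[THEN iffD2] always_eventually allI impI)
        fix t :: real assume "t \<noteq> 0"
        then have eq: "(F (x + t *\<^sub>R e) - F x) /\<^sub>R t - pderiv_k k F x
            = (F (x + t *\<^sub>R e) - F x - t *\<^sub>R pderiv_k k F x) /\<^sub>R t"
          by (simp add: scaleR_diff_right)
        show "norm (F (x + t *\<^sub>R e) - F x - t *\<^sub>R pderiv_k k F x) / norm t
            = norm ((F (x + t *\<^sub>R e) - F x) /\<^sub>R t - pderiv_k k F x)"
          unfolding eq norm_scaleR by (simp add: divide_inverse)
      qed
      ultimately have "((\<lambda>t. norm ((F (x + t *\<^sub>R e) - F x) /\<^sub>R t - pderiv_k k F x)) \<longlongrightarrow> 0) (at 0)"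
        by (rule Lim_transform_eventually)
      then have "((\<lambda>t. (F (x + t *\<^sub>R e) - F x) /\<^sub>R t) \<longlongrightarrow> pderiv_k k F x) (at 0)"
        by (rule Lim_null[THEN iffD2, OF tendsto_norm_zero_cancel])
      moreover have "filterlim s (at 0) sequentially"
        unfolding filterlim_at s_def using LIMSEQ_inverse_real_of_nat by auto
      ultimately show "(\<lambda>m. (F (x + s m *\<^sub>R e) - F x) /\<^sub>R s m) \<longlonglongrightarrow> pderiv_k k F x"
        by (rule filterlim_compose)
    qed
    show "AE x in lborel. norm ((F (x + s m *\<^sub>R e) - F x) /\<^sub>R s m) \<le> indicator (cball 0 (R + 1)) x *\<^sub>R B" for m
    proof (intro AE_I2)
      fix x :: "real ^ 'n"
      show "norm ((F (x + s m *\<^sub>R e) - F x) /\<^sub>R s m) \<le> indicator (cball 0 (R + 1)) x *\<^sub>R B"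
      proof (cases "x \<in> cball 0 (R + 1)")
        case True
        have "norm (F (x + s m *\<^sub>R e) - F x) / s m \<le> B"
          using quot_bound[of x m] s[of m] by (simp add: pos_divide_le_eq)
        then show ?thesis using True s[of m]
          by (simp add: divide_inverse mult.commute del: scaleR_right_diff_distrib)
      next
        case False
        have "norm x \<le> norm (x + s m *\<^sub>R e) + norm (s m *\<^sub>R e)"
          using norm_triangle_ineq4[of "x + s m *\<^sub>R e" "s m *\<^sub>R e"] by simp
        then have "R < norm (x + s m *\<^sub>R e)" using False s[of m] e by simp
        moreover have "R < norm x" using False by simp
        ultimately have "x + s m *\<^sub>R e \<notin> K" "x \<notin> K" using R by (meson not_le)+
        then show ?thesis using K(2) B0 by (simp add: indicator_def)
      qed
    qed
  qed
  moreover have "(LINT x|lborel. (F (x + s m *\<^sub>R e) - F x) /\<^sub>R s m) = 0" for m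
  proof -
    have int: "integrable lborel F"
      using continuous_compact_support_integrable[OF contF K] .
    have "integrable (distr lborel borel ((+) (s m *\<^sub>R e))) F"
      using int by (simp add: lborel_distr_plus)
    then have int': "integrable lborel (\<lambda>x. F (x + s m *\<^sub>R e))"
      by (subst (asm) integrable_distr_eq) (auto simp: add.commute intro!: borel_measurable_continuous_onI contF)
    have "(LINT x|lborel. F x) = (LINT x|distr lborel borel ((+) (s m *\<^sub>R e)). F x)"
      by (simp add: lborel_distr_plus)
    also have "\<dots> = (LINT x|lborel. F (x + s m *\<^sub>R e))"
      by (subst integral_distr) (auto simp: add.commute intro!: borel_measurable_continuous_onI contF)
    finally show ?thesis using int int' by simp
  qed
  ultimately have "(\<lambda>m::nat. 0) \<longlonglongrightarrow> (LINT x|lborel. pderiv_k k F x)"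
    by (simp only:)
  then show ?thesis by (simp add: LIMSEQ_const_iff)
qed

text \<open>The derivative of \<open>cnj \<phi> * \<psi>\<close> has integral zero, which is the product rule integrated.\<close>

lemma test_fun_integration_by_parts:
  assumes \<Omega>: "open \<Omega>" and \<phi>: "\<phi> \<in> test_funs \<Omega>" and \<psi>: "\<psi> \<in> test_funs \<Omega>"
  shows "L2_inner \<Omega> \<phi> (pderiv_k k \<psi>) = - L2_inner \<Omega> (pderiv_k k \<phi>) \<psi>"
proof -
  define F where "F x = cnj (\<phi> x) * \<psi> x" for x
  obtain K where K: "compact K" "K \<subseteq> \<Omega>" "\<And>x. x \<notin> K \<Longrightarrow> \<phi> x = 0"
    using \<phi> by (metis test_fun_support)
  have F: "C_k m F" for m
    unfolding F_def by (intro C_k_mult C_k_cnj test_fun_C_k[OF \<phi>] test_fun_C_k[OF \<psi>])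
  have F0: "F x = 0" if "x \<notin> K" for x using K(3)[OF that] by (simp add: F_def)
  have dF: "pderiv_k k F x = cnj (\<phi> x) * pderiv_k k \<psi> x + cnj (pderiv_k k \<phi> x) * \<psi> x" for x
  proof -
    have "(\<lambda>x. cnj (\<phi> x)) differentiable (at x)"
      using C_k_Suc_differentiable[OF C_k_cnj[OF test_fun_C_k[OF \<phi>]]] .
    then show ?thesis
      unfolding F_def by (simp add: pderiv_k_mult pderiv_k_cnj test_fun_differentiable[OF \<phi>] test_fun_differentiable[OF \<psi>])
  qed
  have \<Omega>_leb: "\<Omega> \<inter> space lebesgue \<in> sets lebesgue" using \<Omega> by auto
  have supp: "indicator \<Omega> x *\<^sub>R pderiv_k k F x = pderiv_k k F x" for x
    using pderiv_k_zero_off_support[of K F x k] K(1,2) F0 by (cases "x \<in> \<Omega>") auto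
  have meas: "pderiv_k k F \<in> borel_measurable lborel"
    using borel_measurable_continuous_onI[OF C_k_continuous[of 0 "pderiv_k k F"]] F[of "Suc 0"] by simp
  have "L2_inner \<Omega> \<phi> (pderiv_k k \<psi>) + L2_inner \<Omega> (pderiv_k k \<phi>) \<psi>
      = (LINT x|lebesgue_on \<Omega>. pderiv_k k F x)"
    unfolding L2_inner_def dF
    by (intro Bochner_Integration.integral_add[symmetric] L2_inner_integrable test_fun_L2 \<Omega> \<phi> \<psi> test_fun_pderiv)
  also have "\<dots> = (LINT x|lborel. pderiv_k k F x)"
    unfolding integral_restrict_space[OF \<Omega>_leb] supp by (rule integral_completion[OF meas])
  also have "\<dots> = 0" by (rule integral_pderiv_k_eq_0[OF F K(1) F0])
  finally show ?thesis by (simp add: add_eq_0_iff)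
qed

section \<open>Weak derivatives and Sobolev spaces\<close>

lemma weak_pderiv_graph_iff:
  "(f, g) \<in> weak_pderiv_graph \<Omega> k \<longleftrightarrow> f \<in> L2 \<Omega> \<and> g \<in> L2 \<Omega> \<and>
    (\<forall>\<phi>\<in>test_funs \<Omega>. L2_inner \<Omega> f (pderiv_k k \<phi>) = - L2_inner \<Omega> g \<phi>)"
proof -
  have minus_L2: "(\<lambda>x. - h x) \<in> L2 \<Omega>" if "h \<in> L2 \<Omega>" for h
    using L2_scale[OF that, of "-1"] by simp
  have "(f, g) \<in> weak_pderiv_graph \<Omega> k \<longleftrightarrow> (f, \<lambda>x. - g x) \<in>
     adjoint_graph (L2 \<Omega>) (L2_inner \<Omega>) (L2 \<Omega>) (L2_inner \<Omega>) (test_funs \<Omega>) (pderiv_k k)"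
    (is "?L \<longleftrightarrow> ?R")
  proof
    assume ?R
    then show ?L unfolding weak_pderiv_graph_def mem_Collect_eq
      by (intro exI[of _ f] exI[of _ "\<lambda>x. - g x"]) simp
  qed (auto simp: weak_pderiv_graph_def)
  then show ?thesis
    using minus_L2[of g] minus_L2[of "\<lambda>x. - g x"]
    by (auto simp: adjoint_graph_def L2_inner_minus_left)
qed

lemma weak_pderiv_graph_L2:
  assumes "(f, g) \<in> weak_pderiv_graph \<Omega> k"
  shows "f \<in> L2 \<Omega>" "g \<in> L2 \<Omega>"
  using assms by (auto simp: weak_pderiv_graph_iff)

text \<open>
  Two weak derivatives of the same function have the same inner products with all test functions.
  This makes \<open>weak_pderiv\<close>, a choice among the representatives, linear up to null sets.
\<close>

lemma weak_pderiv_graph_unique: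
  assumes \<Omega>: "open \<Omega>" and fg: "(f, g) \<in> weak_pderiv_graph \<Omega> k" and fh: "(f, h) \<in> weak_pderiv_graph \<Omega> k"
  shows "AE x in lebesgue_on \<Omega>. g x = h x"
proof -
  have "AE x in lebesgue_on \<Omega>. g x - h x = 0"
  proof (rule L2_zero_of_orthogonal_test_funs[OF \<Omega>])
    show "(\<lambda>x. g x - h x) \<in> L2 \<Omega>" using fg fh by (auto simp: weak_pderiv_graph_iff intro: L2_diff)
    fix \<phi> assume \<phi>: "\<phi> \<in> test_funs \<Omega>"
    have "- L2_inner \<Omega> g \<phi> = - L2_inner \<Omega> h \<phi>"
      using fg fh \<phi> unfolding weak_pderiv_graph_iff by metis
    then show "L2_inner \<Omega> (\<lambda>x. g x - h x) \<phi> = 0"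
      using weak_pderiv_graph_L2[OF fg] weak_pderiv_graph_L2[OF fh] test_fun_L2[OF \<Omega> \<phi>]
      by (simp add: L2_inner_diff_left)
  qed
  then show ?thesis by simp
qed

lemma weak_pderiv_graph_diff:
  assumes \<Omega>: "open \<Omega>" and fg: "(f, g) \<in> weak_pderiv_graph \<Omega> k" "(f', g') \<in> weak_pderiv_graph \<Omega> k"
  shows "(\<lambda>x. f x - f' x, \<lambda>x. g x - g' x) \<in> weak_pderiv_graph \<Omega> k"
  using fg by (auto simp: weak_pderiv_graph_iff L2_diff L2_inner_diff_left test_fun_L2[OF \<Omega>] test_fun_pderiv)

text \<open>The weak derivative is a closed operator, being the negative of an adjoint.\<close>

lemma weak_pderiv_graph_closed:
  assumes \<Omega>: "open \<Omega>" and FG: "\<And>m. (F m, G m) \<in> weak_pderiv_graph \<Omega> k"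
    and f: "f \<in> L2 \<Omega>" "(\<lambda>m. L2_norm \<Omega> (\<lambda>x. F m x - f x)) \<longlonglongrightarrow> 0"
    and g: "g \<in> L2 \<Omega>" "(\<lambda>m. L2_norm \<Omega> (\<lambda>x. G m x - g x)) \<longlonglongrightarrow> 0"
  shows "(f, g) \<in> weak_pderiv_graph \<Omega> k"
proof -
  have "L2_inner \<Omega> f (pderiv_k k \<phi>) = - L2_inner \<Omega> g \<phi>" if \<phi>: "\<phi> \<in> test_funs \<Omega>" for \<phi>
  proof (rule LIMSEQ_unique)
    show "(\<lambda>m. L2_inner \<Omega> (F m) (pderiv_k k \<phi>)) \<longlonglongrightarrow> L2_inner \<Omega> f (pderiv_k k \<phi>)"
      using weak_pderiv_graph_L2[OF FG] f test_fun_L2[OF \<Omega> test_fun_pderiv[OF \<phi>]]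
      by (intro L2_inner_tendsto)
    have "(\<lambda>m. - L2_inner \<Omega> (G m) \<phi>) \<longlonglongrightarrow> - L2_inner \<Omega> g \<phi>"
      using weak_pderiv_graph_L2[OF FG] g test_fun_L2[OF \<Omega> \<phi>]
      by (intro tendsto_minus L2_inner_tendsto)
    then show "(\<lambda>m. L2_inner \<Omega> (F m) (pderiv_k k \<phi>)) \<longlonglongrightarrow> - L2_inner \<Omega> g \<phi>"
      using FG \<phi> by (simp add: weak_pderiv_graph_iff)
  qed
  then show ?thesis using f g by (simp add: weak_pderiv_graph_iff)
qed

lemma test_fun_weak_pderiv_graph:
  assumes "open \<Omega>" "\<phi> \<in> test_funs \<Omega>"
  shows "(\<phi>, pderiv_k k \<phi>) \<in> weak_pderiv_graph \<Omega> k"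
  unfolding weak_pderiv_graph_iff
  using assms by (auto intro: test_fun_L2 test_fun_pderiv test_fun_integration_by_parts)

lemma op_apply_graph: "(f, g) \<in> G \<Longrightarrow> (f, op_apply G f) \<in> G"
  unfolding op_apply_def by (rule someI)

lemma W1_weak_pderiv_graph:
  assumes "f \<in> W1 \<Omega>"
  shows "(f, weak_pderiv \<Omega> k f) \<in> weak_pderiv_graph \<Omega> k"
proof -
  have "f \<in> Domain (weak_pderiv_graph \<Omega> k)" using assms by (simp add: W1_def)
  then obtain g where "(f, g) \<in> weak_pderiv_graph \<Omega> k" by (rule DomainE)
  then show ?thesis unfolding weak_pderiv_def by (rule op_apply_graph)
qed

lemma W1I: "(\<And>k. (f, g k) \<in> weak_pderiv_graph \<Omega> k) \<Longrightarrow> f \<in> W1 \<Omega>"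
  unfolding W1_def by auto

lemma W1_L2: "f \<in> W1 \<Omega> \<Longrightarrow> f \<in> L2 \<Omega>" "f \<in> W1 \<Omega> \<Longrightarrow> weak_pderiv \<Omega> k f \<in> L2 \<Omega>"
  using W1_weak_pderiv_graph[of f \<Omega>] weak_pderiv_graph_L2 by blast+

lemma W1_diff:
  assumes \<Omega>: "open \<Omega>" and fg: "f \<in> W1 \<Omega>" "g \<in> W1 \<Omega>"
  shows "(\<lambda>x. f x - g x) \<in> W1 \<Omega>"
    and "AE x in lebesgue_on \<Omega>. weak_pderiv \<Omega> k (\<lambda>x. f x - g x) x = weak_pderiv \<Omega> k f x - weak_pderiv \<Omega> k g x"
proof -
  have *: "(\<lambda>x. f x - g x, \<lambda>x. weak_pderiv \<Omega> k f x - weak_pderiv \<Omega> k g x) \<in> weak_pderiv_graph \<Omega> k" for k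
    using fg by (intro weak_pderiv_graph_diff \<Omega> W1_weak_pderiv_graph)
  show 1: "(\<lambda>x. f x - g x) \<in> W1 \<Omega>" using * by (rule W1I)
  show "AE x in lebesgue_on \<Omega>. weak_pderiv \<Omega> k (\<lambda>x. f x - g x) x = weak_pderiv \<Omega> k f x - weak_pderiv \<Omega> k g x"
    by (rule weak_pderiv_graph_unique[OF \<Omega> W1_weak_pderiv_graph[OF 1] *])
qed

text \<open>
  The norm in the definition of \<open>W1_0\<close> applies \<open>weak_pderiv\<close> to the difference \<open>f - \<phi>\<close>.  It can be
  computed from any weak derivatives of \<open>f\<close> and the classical derivatives of \<open>\<phi>\<close>.
\<close>

lemma W1_norm_diff:
  assumes \<Omega>: "open \<Omega>" and fg: "(\<And>k. (f, g k) \<in> weak_pderiv_graph \<Omega> k)" and \<phi>: "\<phi> \<in> test_funs \<Omega>"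
  shows "W1_norm \<Omega> (\<lambda>x. f x - \<phi> x) = sqrt ((L2_norm \<Omega> (\<lambda>x. \<phi> x - f x))\<^sup>2
    + (\<Sum>k\<in>UNIV. (L2_norm \<Omega> (\<lambda>x. pderiv_k k \<phi> x - g k x))\<^sup>2))"
proof -
  have *: "(\<lambda>x. f x - \<phi> x, \<lambda>x. g k x - pderiv_k k \<phi> x) \<in> weak_pderiv_graph \<Omega> k" for k
    by (intro weak_pderiv_graph_diff \<Omega> fg test_fun_weak_pderiv_graph \<phi>)
  have "L2_norm \<Omega> (weak_pderiv \<Omega> k (\<lambda>x. f x - \<phi> x)) = L2_norm \<Omega> (\<lambda>x. g k x - pderiv_k k \<phi> x)" for k
    using W1_weak_pderiv_graph[OF W1I[OF *]] *
    by (intro L2_norm_cong_AE weak_pderiv_graph_unique[OF \<Omega>]) (auto dest: weak_pderiv_graph_L2)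
  then show ?thesis
    unfolding W1_norm_def by (simp add: L2_norm_diff_commute[of \<Omega> "g _"] L2_norm_diff_commute[of \<Omega> f])
qed

lemma W1_0_approximation:
  assumes \<Omega>: "open \<Omega>" and f: "f \<in> W1_0 \<Omega>"
  obtains \<phi> where "\<And>m::nat. \<phi> m \<in> test_funs \<Omega>" "(\<lambda>m. L2_norm \<Omega> (\<lambda>x. \<phi> m x - f x)) \<longlonglongrightarrow> 0"
    "\<And>k. (\<lambda>m. L2_norm \<Omega> (\<lambda>x. pderiv_k k (\<phi> m) x - weak_pderiv \<Omega> k f x)) \<longlonglongrightarrow> 0"
proof -
  have W1: "f \<in> W1 \<Omega>" and "\<forall>m. \<exists>\<phi>\<in>test_funs \<Omega>. W1_norm \<Omega> (\<lambda>x. f x - \<phi> x) < inverse (real (Suc m))"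
    using f by (auto simp: W1_0_def)
  then obtain \<phi> where \<phi>: "\<And>m. \<phi> m \<in> test_funs \<Omega>"
      and small: "\<And>m. W1_norm \<Omega> (\<lambda>x. f x - \<phi> m x) < inverse (real (Suc m))"
    by metis
  note norm_eq = W1_norm_diff[OF \<Omega> W1_weak_pderiv_graph[OF W1] \<phi>]
  have squeeze: "a \<longlonglongrightarrow> 0" if "\<And>m. 0 \<le> a m" "\<And>m. a m \<le> W1_norm \<Omega> (\<lambda>x. f x - \<phi> m x)" for a
  proof (rule tendsto_sandwich[OF _ _ tendsto_const LIMSEQ_inverse_real_of_nat])
    show "\<forall>\<^sub>F m in sequentially. a m \<le> inverse (real (Suc m))"
      using that(2) small by (intro always_eventually allI) (meson less_imp_le order_trans)
  qed (use that(1) in auto)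
  show ?thesis
  proof (rule that[OF \<phi>])
    show "(\<lambda>m. L2_norm \<Omega> (\<lambda>x. \<phi> m x - f x)) \<longlonglongrightarrow> 0"
      by (rule squeeze) (auto simp: norm_eq intro!: real_le_rsqrt sum_nonneg)
    show "(\<lambda>m. L2_norm \<Omega> (\<lambda>x. pderiv_k k (\<phi> m) x - weak_pderiv \<Omega> k f x)) \<longlonglongrightarrow> 0" for k
      by (rule squeeze)
        (auto simp: norm_eq intro!: real_le_rsqrt add_increasing member_le_sum
          [where f = "\<lambda>k. (L2_norm \<Omega> (\<lambda>x. pderiv_k k (\<phi> _) x - weak_pderiv \<Omega> k f x))\<^sup>2"])
  qed
qed

text \<open>
  Converse of the approximation property, by closedness of the weak derivatives.  It is how
  functions are recognized as elements of \<open>W1_0\<close>.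
\<close>

lemma W1_0_limit:
  assumes \<Omega>: "open \<Omega>" and \<phi>: "\<And>m::nat. \<phi> m \<in> test_funs \<Omega>"
    and f: "f \<in> L2 \<Omega>" "(\<lambda>m. L2_norm \<Omega> (\<lambda>x. \<phi> m x - f x)) \<longlonglongrightarrow> 0"
    and g: "\<And>k. g k \<in> L2 \<Omega>" "\<And>k. (\<lambda>m. L2_norm \<Omega> (\<lambda>x. pderiv_k k (\<phi> m) x - g k x)) \<longlonglongrightarrow> 0"
  shows "f \<in> W1_0 \<Omega>" and "(f, g k) \<in> weak_pderiv_graph \<Omega> k"
proof -
  have fg: "(f, g k) \<in> weak_pderiv_graph \<Omega> k" for k
    by (rule weak_pderiv_graph_closed[OF \<Omega> test_fun_weak_pderiv_graph[OF \<Omega> \<phi>] f g])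
  then show "(f, g k) \<in> weak_pderiv_graph \<Omega> k" .
  have "(\<lambda>m. W1_norm \<Omega> (\<lambda>x. f x - \<phi> m x)) \<longlonglongrightarrow> sqrt (0\<^sup>2 + (\<Sum>k\<in>(UNIV::'a set). 0\<^sup>2))"
    unfolding W1_norm_diff[OF \<Omega> fg \<phi>]
    by (intro tendsto_real_sqrt tendsto_add tendsto_power tendsto_sum f g)
  then have lim: "(\<lambda>m. W1_norm \<Omega> (\<lambda>x. f x - \<phi> m x)) \<longlonglongrightarrow> 0" by simp
  have "\<exists>\<psi>\<in>test_funs \<Omega>. W1_norm \<Omega> (\<lambda>x. f x - \<psi> x) < e" if "0 < e" for e
  proof -
    have "\<forall>\<^sub>F m in sequentially. W1_norm \<Omega> (\<lambda>x. f x - \<phi> m x) < e"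
      using lim that by (rule order_tendstoD)
    then obtain m where "W1_norm \<Omega> (\<lambda>x. f x - \<phi> m x) < e"
      by (auto dest: eventually_happens)
    with \<phi> show ?thesis by blast
  qed
  then show "f \<in> W1_0 \<Omega>" using W1I[OF fg] by (simp add: W1_0_def)
qed

lemma W1_0_W1: "f \<in> W1_0 \<Omega> \<Longrightarrow> f \<in> W1 \<Omega>"
  by (simp add: W1_0_def)

lemma test_fun_W1_0:
  assumes \<Omega>: "open \<Omega>" and \<phi>: "\<phi> \<in> test_funs \<Omega>"
  shows "\<phi> \<in> W1_0 \<Omega>"
  by (rule W1_0_limit(1)[OF \<Omega>, where \<phi> = "\<lambda>_. \<phi>" and g = "\<lambda>k. pderiv_k k \<phi>"])
    (auto simp: L2_norm_def intro: test_fun_L2 test_fun_pderiv assms)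

lemma W1_0_diff:
  assumes \<Omega>: "open \<Omega>" and f: "f \<in> W1_0 \<Omega>" and g: "g \<in> W1_0 \<Omega>"
  shows "(\<lambda>x. f x - g x) \<in> W1_0 \<Omega>"
proof -
  note W1 = W1_0_W1[OF f] W1_0_W1[OF g]
  obtain \<phi> where \<phi>: "\<And>m::nat. \<phi> m \<in> test_funs \<Omega>" "(\<lambda>m. L2_norm \<Omega> (\<lambda>x. \<phi> m x - f x)) \<longlonglongrightarrow> 0"
    "\<And>k. (\<lambda>m. L2_norm \<Omega> (\<lambda>x. pderiv_k k (\<phi> m) x - weak_pderiv \<Omega> k f x)) \<longlonglongrightarrow> 0"
    by (rule W1_0_approximation[OF \<Omega> f]) (rule that)
  obtain \<psi> where \<psi>: "\<And>m::nat. \<psi> m \<in> test_funs \<Omega>" "(\<lambda>m. L2_norm \<Omega> (\<lambda>x. \<psi> m x - g x)) \<longlonglongrightarrow> 0"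
    "\<And>k. (\<lambda>m. L2_norm \<Omega> (\<lambda>x. pderiv_k k (\<psi> m) x - weak_pderiv \<Omega> k g x)) \<longlonglongrightarrow> 0"
    by (rule W1_0_approximation[OF \<Omega> g]) (rule that)
  have lim_diff: "(\<lambda>m. L2_norm \<Omega> (\<lambda>x. (F m x - G m x) - (a x - b x))) \<longlonglongrightarrow> 0"
    if "\<And>m. F m \<in> L2 \<Omega>" "\<And>m. G m \<in> L2 \<Omega>" "a \<in> L2 \<Omega>" "b \<in> L2 \<Omega>"
      "(\<lambda>m. L2_norm \<Omega> (\<lambda>x. F m x - a x)) \<longlonglongrightarrow> 0" "(\<lambda>m. L2_norm \<Omega> (\<lambda>x. G m x - b x)) \<longlonglongrightarrow> 0"
    for F G :: "nat \<Rightarrow> 'a cfun" and a b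
  proof (rule tendsto_sandwich[OF _ _ tendsto_const])
    show "(\<lambda>m. L2_norm \<Omega> (\<lambda>x. F m x - a x) + L2_norm \<Omega> (\<lambda>x. G m x - b x)) \<longlonglongrightarrow> 0"
      using tendsto_add[OF that(5,6)] by simp
    have "L2_norm \<Omega> (\<lambda>x. (F m x - G m x) - (a x - b x))
        \<le> L2_norm \<Omega> (\<lambda>x. F m x - a x) + L2_norm \<Omega> (\<lambda>x. G m x - b x)" for m
      using L2_norm_triangle[OF L2_diff[OF that(1,3), of m] L2_diff[OF that(4,2), of m]]
      by (simp add: L2_norm_diff_commute[of \<Omega> b] algebra_simps)
    then show "\<forall>\<^sub>F m in sequentially. L2_norm \<Omega> (\<lambda>x. (F m x - G m x) - (a x - b x))
        \<le> L2_norm \<Omega> (\<lambda>x. F m x - a x) + L2_norm \<Omega> (\<lambda>x. G m x - b x)"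
      by simp
  qed simp
  show ?thesis
  proof (rule W1_0_limit(1)[OF \<Omega>, where \<phi> = "\<lambda>m x. \<phi> m x - \<psi> m x"
        and g = "\<lambda>k x. weak_pderiv \<Omega> k f x - weak_pderiv \<Omega> k g x"])
    show "(\<lambda>m. L2_norm \<Omega> (\<lambda>x. \<phi> m x - \<psi> m x - (f x - g x))) \<longlonglongrightarrow> 0"
      using \<phi> \<psi> W1 by (intro lim_diff test_fun_L2 \<Omega> W1_L2)
    show "(\<lambda>m. L2_norm \<Omega> (\<lambda>x. pderiv_k k (\<lambda>x. \<phi> m x - \<psi> m x) x
        - (weak_pderiv \<Omega> k f x - weak_pderiv \<Omega> k g x))) \<longlonglongrightarrow> 0" for k
      using \<phi> \<psi> W1 unfolding pderiv_k_test_diff[OF \<phi>(1) \<psi>(1)]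
      by (intro lim_diff test_fun_L2 \<Omega> test_fun_pderiv W1_L2)
  qed (use \<phi> \<psi> W1 in \<open>auto intro: test_fun_diff L2_diff W1_L2\<close>)
qed

section \<open>The weak Dirichlet problem\<close>

lemma L2_inner_cong_AE:
  assumes "f \<in> L2 \<Omega>" "f' \<in> L2 \<Omega>" "g \<in> L2 \<Omega>" "g' \<in> L2 \<Omega>"
    and "AE x in lebesgue_on \<Omega>. f x = f' x" "AE x in lebesgue_on \<Omega>. g x = g' x"
  shows "L2_inner \<Omega> f g = L2_inner \<Omega> f' g'"
  unfolding L2_inner_def
proof (rule integral_cong_AE)
  show "AE x in lebesgue_on \<Omega>. cnj (f x) * g x = cnj (f' x) * g' x"
    using assms(5,6) by eventually_elim simp
qed (use L2_inner_integrable assms(1-4) in \<open>auto intro: borel_measurable_integrable\<close>)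

definition weighted_form ::
  "(real ^ 'n) set \<Rightarrow> (real ^ 'n \<Rightarrow> real) \<Rightarrow> ('n \<Rightarrow> 'n::finite cfun) \<Rightarrow> ('n \<Rightarrow> 'n cfun) \<Rightarrow> complex" where
  "weighted_form \<Omega> w F G = (\<Sum>k\<in>UNIV. L2_inner \<Omega> (F k) (\<lambda>x. complex_of_real (w x) * G k x))"

text \<open>
  In the application, the weight is the reciprocal of a coefficient.  The lower bound \<open>\<alpha>\<close> makes the form
  coercive, the upper bound \<open>\<beta>\<close> keeps weighted gradients square-integrable.
\<close>

locale elliptic_weight =
  fixes \<Omega> :: "(real ^ 'n::finite) set" and w :: "real ^ 'n \<Rightarrow> real" and \<alpha> \<beta> :: real
  assumes open_domain: "open \<Omega>"
    and weight_measurable: "w \<in> borel_measurable (lebesgue_on \<Omega>)"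
    and weight_lower_pos: "0 < \<alpha>"
    and weight_bounds: "AE x in lebesgue_on \<Omega>. \<alpha> \<le> w x \<and> w x \<le> \<beta>"
begin

lemma cmod_weight_le: "AE x in lebesgue_on \<Omega>. cmod (complex_of_real (w x)) \<le> \<bar>\<beta>\<bar>"
  using weight_bounds by eventually_elim (use weight_lower_pos in auto)

lemma weight_L2: "f \<in> L2 \<Omega> \<Longrightarrow> (\<lambda>x. complex_of_real (w x) * f x) \<in> L2 \<Omega>"
  using weight_measurable cmod_weight_le by (intro L2_mult_bounded[where K = "\<bar>\<beta>\<bar>"]) auto

lemma weight_L2_norm: "f \<in> L2 \<Omega> \<Longrightarrow> L2_norm \<Omega> (\<lambda>x. complex_of_real (w x) * f x) \<le> \<bar>\<beta>\<bar> * L2_norm \<Omega> f"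
  using weight_measurable cmod_weight_le by (intro L2_norm_mult_bounded) auto

lemma weighted_form_add_right:
  assumes "\<And>k. F k \<in> L2 \<Omega>" "\<And>k. G k \<in> L2 \<Omega>" "\<And>k. H k \<in> L2 \<Omega>"
  shows "weighted_form \<Omega> w F (\<lambda>k x. G k x + H k x) = weighted_form \<Omega> w F G + weighted_form \<Omega> w F H"
  unfolding weighted_form_def distrib_left
  by (simp add: L2_inner_add_right assms weight_L2 sum.distrib)

lemma weighted_form_add_left:
  assumes "\<And>k. F k \<in> L2 \<Omega>" "\<And>k. G k \<in> L2 \<Omega>" "\<And>k. H k \<in> L2 \<Omega>"
  shows "weighted_form \<Omega> w (\<lambda>k x. G k x + H k x) F = weighted_form \<Omega> w G F + weighted_form \<Omega> w H F"
  unfolding weighted_form_def by (simp add: L2_inner_add_left assms weight_L2 sum.distrib)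

lemma weighted_form_diff_left:
  assumes "\<And>k. F k \<in> L2 \<Omega>" "\<And>k. G k \<in> L2 \<Omega>" "\<And>k. H k \<in> L2 \<Omega>"
  shows "weighted_form \<Omega> w (\<lambda>k x. G k x - H k x) F = weighted_form \<Omega> w G F - weighted_form \<Omega> w H F"
  unfolding weighted_form_def by (simp add: L2_inner_diff_left assms weight_L2 sum_subtractf)

end

lemma weighted_form_scale_right: "weighted_form \<Omega> w F (\<lambda>k x. c * G k x) = c * weighted_form \<Omega> w F G"
  unfolding weighted_form_def mult.left_commute[of _ c] by (simp add: L2_inner_scale_right sum_distrib_left)

lemma weighted_form_scale_left: "weighted_form \<Omega> w (\<lambda>k x. c * G k x) F = cnj c * weighted_form \<Omega> w G F"
  unfolding weighted_form_def by (simp add: L2_inner_scale_left sum_distrib_left)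

lemma weighted_form_commute: "weighted_form \<Omega> w G F = cnj (weighted_form \<Omega> w F G)"
proof -
  have "L2_inner \<Omega> (G k) (\<lambda>x. complex_of_real (w x) * F k x)
      = cnj (L2_inner \<Omega> (F k) (\<lambda>x. complex_of_real (w x) * G k x))" for k
    using L2_inner_commute[of \<Omega> "\<lambda>x. complex_of_real (w x) * G k x" "F k"]
    by (simp add: L2_inner_mult_real)
  then show ?thesis by (simp add: weighted_form_def)
qed

context elliptic_weight
begin

lemma weighted_form_coercive:
  assumes F: "\<And>k. F k \<in> L2 \<Omega>"
  shows "\<alpha> * (\<Sum>k\<in>UNIV. (L2_norm \<Omega> (F k))\<^sup>2) \<le> Re (weighted_form \<Omega> w F F)"
proof -
  have "\<alpha> * (L2_norm \<Omega> f)\<^sup>2 \<le> Re (L2_inner \<Omega> f (\<lambda>x. complex_of_real (w x) * f x))"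
    if f: "f \<in> L2 \<Omega>" for f
  proof -
    have eq: "cnj (f x) * (complex_of_real (w x) * f x) = complex_of_real (w x * (cmod (f x))\<^sup>2)" for x
      by (simp only: of_real_mult complex_norm_square mult_ac)
    have "integrable (lebesgue_on \<Omega>) (\<lambda>x. complex_of_real (w x * (cmod (f x))\<^sup>2))"
      using L2_inner_integrable[OF f weight_L2[OF f]] by (simp only: eq)
    then have int: "integrable (lebesgue_on \<Omega>) (\<lambda>x. w x * (cmod (f x))\<^sup>2)"
      by (simp only: complex_of_real_integrable_eq)
    have "\<alpha> * (L2_norm \<Omega> f)\<^sup>2 = (LINT x|lebesgue_on \<Omega>. \<alpha> * (cmod (f x))\<^sup>2)"
      by (simp add: L2_norm_power2)
    also have "\<dots> \<le> (LINT x|lebesgue_on \<Omega>. w x * (cmod (f x))\<^sup>2)"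
    proof (intro integral_mono_AE integrable_mult_right L2_integrable[OF f] int)
      show "AE x in lebesgue_on \<Omega>. \<alpha> * (cmod (f x))\<^sup>2 \<le> w x * (cmod (f x))\<^sup>2"
        using weight_bounds by eventually_elim (simp add: mult_right_mono)
    qed
    also have "\<dots> = Re (L2_inner \<Omega> f (\<lambda>x. complex_of_real (w x) * f x))"
      unfolding L2_inner_def eq integral_complex_of_real by simp
    finally show ?thesis .
  qed
  then show ?thesis
    unfolding weighted_form_def sum_distrib_left Re_sum by (intro sum_mono) (simp add: F)
qed

definition energy :: "'n cfun \<Rightarrow> real" where
  "energy \<phi> = Re (weighted_form \<Omega> w (grad \<phi>) (grad \<phi>))"

lemma grad_L2: "\<phi> \<in> test_funs \<Omega> \<Longrightarrow> grad \<phi> k \<in> L2 \<Omega>"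
  by (simp add: grad_def test_fun_L2 open_domain test_fun_pderiv)

lemma energy_coercive:
  assumes "\<phi> \<in> test_funs \<Omega>"
  shows "\<alpha> * (L2_norm \<Omega> (pderiv_k k \<phi>))\<^sup>2 \<le> energy \<phi>"
proof -
  have "(L2_norm \<Omega> (grad \<phi> k))\<^sup>2 \<le> (\<Sum>k\<in>UNIV. (L2_norm \<Omega> (grad \<phi> k))\<^sup>2)"
    by (rule member_le_sum) auto
  then have "\<alpha> * (L2_norm \<Omega> (grad \<phi> k))\<^sup>2 \<le> \<alpha> * (\<Sum>k\<in>UNIV. (L2_norm \<Omega> (grad \<phi> k))\<^sup>2)"
    using weight_lower_pos by (intro mult_left_mono) auto
  also have "\<dots> \<le> energy \<phi>"
    unfolding energy_def by (intro weighted_form_coercive grad_L2 assms)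
  finally show ?thesis by (simp add: grad_def)
qed

lemma energy_nonneg: "\<phi> \<in> test_funs \<Omega> \<Longrightarrow> 0 \<le> energy \<phi>"
  using energy_coercive[of \<phi> undefined] weight_lower_pos
  by (meson mult_nonneg_nonneg less_imp_le order_trans zero_le_power2)

lemma energy_add_scale:
  assumes \<phi>: "\<phi> \<in> test_funs \<Omega>" and \<psi>: "\<psi> \<in> test_funs \<Omega>"
  shows "energy (\<lambda>x. \<phi> x + complex_of_real t * \<psi> x)
    = energy \<phi> + 2 * t * Re (weighted_form \<Omega> w (grad \<phi>) (grad \<psi>)) + t\<^sup>2 * energy \<psi>"
proof -
  have grad_eq: "grad (\<lambda>x. \<phi> x + complex_of_real t * \<psi> x) = (\<lambda>k x. grad \<phi> k x + complex_of_real t * grad \<psi> k x)"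
    unfolding grad_def using \<phi> \<psi> by (simp add: pderiv_k_test_add test_fun_scale pderiv_k_test_scale)
  have "Re (weighted_form \<Omega> w (grad \<psi>) (grad \<phi>)) = Re (weighted_form \<Omega> w (grad \<phi>) (grad \<psi>))"
    by (subst weighted_form_commute) simp
  then show ?thesis
    unfolding energy_def grad_eq using \<phi> \<psi>
    by (simp add: weighted_form_add_left weighted_form_add_right grad_L2 L2_add L2_scale
        weighted_form_scale_left weighted_form_scale_right algebra_simps power2_eq_square)
qed

text \<open>
  Perturbing a function whose value is within \<open>\<delta>\<close> of the infimum in the direction \<open>\<psi>\<close> cannot
  lower the functional by more than \<open>\<delta>\<close>.  The discriminant of the resulting quadratic polynomial
  bounds the residual of the weak equation by the energy of \<open>\<psi>\<close>, uniformly in \<open>\<psi>\<close>.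
\<close>

lemma almost_minimizer_residual:
  assumes f: "f \<in> L2 \<Omega>" and \<phi>: "\<phi> \<in> test_funs \<Omega>" and \<psi>: "\<psi> \<in> test_funs \<Omega>"
    and min: "\<And>\<theta>. \<theta> \<in> test_funs \<Omega> \<Longrightarrow>
      energy \<phi> - 2 * Re (L2_inner \<Omega> f \<phi>) \<le> energy \<theta> - 2 * Re (L2_inner \<Omega> f \<theta>) + \<delta>"
  shows "\<bar>Re (weighted_form \<Omega> w (grad \<phi>) (grad \<psi>)) - Re (L2_inner \<Omega> f \<psi>)\<bar> \<le> sqrt \<delta> * sqrt (energy \<psi>)"
proof -
  define r where "r = Re (weighted_form \<Omega> w (grad \<phi>) (grad \<psi>)) - Re (L2_inner \<Omega> f \<psi>)"
  have "0 \<le> energy \<psi> * t\<^sup>2 + 2 * r * t + \<delta>" for t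
  proof -
    have "(\<lambda>x. \<phi> x + complex_of_real t * \<psi> x) \<in> test_funs \<Omega>"
      by (intro test_fun_add test_fun_scale \<phi> \<psi>)
    from min[OF this] show ?thesis
      using \<phi> \<psi> f
      by (simp add: energy_add_scale L2_inner_add_right L2_inner_scale_right L2_scale
          test_fun_L2 open_domain r_def algebra_simps)
  qed
  then have "r\<^sup>2 \<le> energy \<psi> * \<delta>"
    by (rule discriminant_le_of_nonneg) (rule energy_nonneg[OF \<psi>])
  then have "sqrt (r\<^sup>2) \<le> sqrt (energy \<psi> * \<delta>)" by (rule real_sqrt_le_mono)
  then show ?thesis by (simp add: r_def real_sqrt_mult mult.commute)
qed

text \<open>
  A minimizing sequence of the Dirichlet functional is Cauchy in energy, since the energy of a
  difference is a difference of two residuals.  Coercivity and the Poincare inequality turn this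
  into convergence of the sequence and of its gradients in \<open>L2\<close>.
\<close>

theorem weak_solution_exists:
  assumes f: "f \<in> L2 \<Omega>" and c: "0 < c"
    and poincare: "\<And>\<phi>. \<phi> \<in> test_funs \<Omega> \<Longrightarrow> c * L2_norm \<Omega> \<phi> \<le> L2_norm \<Omega> (pderiv_k j \<phi>)"
  obtains u where "u \<in> W1_0 \<Omega>"
    "\<And>\<psi>. \<psi> \<in> test_funs \<Omega> \<Longrightarrow> weighted_form \<Omega> w (weak_grad \<Omega> u) (grad \<psi>) = L2_inner \<Omega> f \<psi>"
proof -
  define J where "J \<phi> = energy \<phi> - 2 * Re (L2_inner \<Omega> f \<phi>)" for \<phi>
  have energy_L2: "\<alpha> * c\<^sup>2 * (L2_norm \<Omega> \<phi>)\<^sup>2 \<le> energy \<phi>" if \<phi>: "\<phi> \<in> test_funs \<Omega>" for \<phi>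
  proof -
    have "(c * L2_norm \<Omega> \<phi>)\<^sup>2 \<le> (L2_norm \<Omega> (pderiv_k j \<phi>))\<^sup>2"
      using c by (intro power_mono poincare \<phi>) auto
    then have "\<alpha> * (c * L2_norm \<Omega> \<phi>)\<^sup>2 \<le> \<alpha> * (L2_norm \<Omega> (pderiv_k j \<phi>))\<^sup>2"
      using weight_lower_pos by (intro mult_left_mono) auto
    also have "\<dots> \<le> energy \<phi>" by (rule energy_coercive[OF \<phi>])
    finally show ?thesis by (simp add: power_mult_distrib mult.assoc)
  qed
  define a where "a = \<alpha> * c\<^sup>2"
  have a: "0 < a" using c weight_lower_pos by (simp add: a_def)
  have J_lower: "- ((L2_norm \<Omega> f)\<^sup>2 / a) \<le> J \<phi>" if \<phi>: "\<phi> \<in> test_funs \<Omega>" for \<phi>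
  proof -
    have "Re (L2_inner \<Omega> f \<phi>) \<le> L2_norm \<Omega> f * L2_norm \<Omega> \<phi>"
      using L2_Cauchy_Schwarz_Re[OF f test_fun_L2[OF open_domain \<phi>]] by simp
    moreover have "a * (L2_norm \<Omega> \<phi>)\<^sup>2 \<le> energy \<phi>" using energy_L2[OF \<phi>] by (simp add: a_def)
    \<comment> \<open>completing the square in \<open>a x\<^sup>2 - 2 \<parallel>f\<parallel> x\<close> with \<open>x = \<parallel>\<phi>\<parallel>\<close>\<close>
    moreover have "0 \<le> (a * L2_norm \<Omega> \<phi> - L2_norm \<Omega> f)\<^sup>2 / a" using a by simp
    moreover have "(a * L2_norm \<Omega> \<phi> - L2_norm \<Omega> f)\<^sup>2 / a
        = a * (L2_norm \<Omega> \<phi>)\<^sup>2 - 2 * (L2_norm \<Omega> f * L2_norm \<Omega> \<phi>) + (L2_norm \<Omega> f)\<^sup>2 / a"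
      using a by (simp add: field_simps power2_eq_square)
    ultimately show ?thesis unfolding J_def by linarith
  qed
  then have bdd: "bdd_below (J ` test_funs \<Omega>)" by (auto intro!: bdd_belowI)
  define \<delta> where "\<delta> m = inverse (real (Suc m))" for m
  have \<delta>: "0 < \<delta> m" for m by (simp add: \<delta>_def)
  have "\<exists>\<phi>\<in>test_funs \<Omega>. J \<phi> < Inf (J ` test_funs \<Omega>) + \<delta> m" for m
    using cInf_lessD[of "J ` test_funs \<Omega>" "Inf (J ` test_funs \<Omega>) + \<delta> m"] \<delta>[of m] test_fun_zero by auto
  then obtain \<phi> where \<phi>: "\<And>m. \<phi> m \<in> test_funs \<Omega>"
      and J\<phi>: "\<And>m. J (\<phi> m) < Inf (J ` test_funs \<Omega>) + \<delta> m"
    by metis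
  have min: "J (\<phi> m) \<le> J \<theta> + \<delta> m" if "\<theta> \<in> test_funs \<Omega>" for m \<theta>
    using J\<phi>[of m] cInf_lower[OF imageI[OF that] bdd] by linarith
  have residual: "\<bar>Re (weighted_form \<Omega> w (grad (\<phi> m)) (grad \<psi>)) - Re (L2_inner \<Omega> f \<psi>)\<bar> \<le> sqrt (\<delta> m) * sqrt (energy \<psi>)"
    if "\<psi> \<in> test_funs \<Omega>" for m \<psi>
    using min unfolding J_def by (intro almost_minimizer_residual f \<phi> that)
  have energy_Cauchy: "energy (\<lambda>x. \<phi> m x - \<phi> l x) \<le> (sqrt (\<delta> m) + sqrt (\<delta> l))\<^sup>2" for m l
  proof -
    define d where "d x = \<phi> m x - \<phi> l x" for x
    have d: "d \<in> test_funs \<Omega>" unfolding d_def by (intro test_fun_diff \<phi>)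
    have "grad d = (\<lambda>k x. grad (\<phi> m) k x - grad (\<phi> l) k x)"
      unfolding d_def grad_def pderiv_k_test_diff[OF \<phi> \<phi>] ..
    then have "energy d = Re (weighted_form \<Omega> w (\<lambda>k x. grad (\<phi> m) k x - grad (\<phi> l) k x) (grad d))"
      unfolding energy_def by simp
    also have "\<dots> = Re (weighted_form \<Omega> w (grad (\<phi> m)) (grad d)) - Re (weighted_form \<Omega> w (grad (\<phi> l)) (grad d))"
      by (simp add: weighted_form_diff_left grad_L2 \<phi> d)
    also have "\<dots> \<le> sqrt (\<delta> m) * sqrt (energy d) + sqrt (\<delta> l) * sqrt (energy d)"
      using residual[OF d, of m] residual[OF d, of l] by linarith
    finally have le: "energy d \<le> (sqrt (\<delta> m) + sqrt (\<delta> l)) * sqrt (energy d)" by (simp add: distrib_right)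
    have e: "energy d = (sqrt (energy d))\<^sup>2" using energy_nonneg[OF d] by simp
    have "sqrt (energy d) \<le> sqrt (\<delta> m) + sqrt (\<delta> l)"
    proof (cases "energy d = 0")
      case False
      then have "0 < sqrt (energy d)" using energy_nonneg[OF d] by simp
      moreover have "sqrt (energy d) * sqrt (energy d) \<le> (sqrt (\<delta> m) + sqrt (\<delta> l)) * sqrt (energy d)"
        using le e by (simp add: power2_eq_square)
      ultimately show ?thesis using mult_right_le_imp_le by blast
    qed (use \<delta> in \<open>simp add: less_imp_le\<close>)
    then have "(sqrt (energy d))\<^sup>2 \<le> (sqrt (\<delta> m) + sqrt (\<delta> l))\<^sup>2"
      using energy_nonneg[OF d] by (intro power_mono) auto
    then show ?thesis using e by (simp add: d_def[abs_def])
  qed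
  have \<delta>_tendsto: "\<delta> \<longlonglongrightarrow> 0" unfolding \<delta>_def by (rule LIMSEQ_inverse_real_of_nat)
  have Cauchy: "\<exists>N. \<forall>m\<ge>N. \<forall>l\<ge>N. L2_norm \<Omega> (\<lambda>x. A (\<phi> m) x - A (\<phi> l) x) \<le> \<epsilon>"
    if A: "\<And>m l. b * (L2_norm \<Omega> (\<lambda>x. A (\<phi> m) x - A (\<phi> l) x))\<^sup>2 \<le> energy (\<lambda>x. \<phi> m x - \<phi> l x)"
      and b: "0 < b" and \<epsilon>: "0 < \<epsilon>" for A :: "'n cfun \<Rightarrow> 'n cfun" and b \<epsilon>
  proof -
    have "0 < b * \<epsilon>\<^sup>2 / 4" using b \<epsilon> by simp
    then obtain N where N: "\<And>m. N \<le> m \<Longrightarrow> \<delta> m < b * \<epsilon>\<^sup>2 / 4"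
      using order_tendstoD(2)[OF \<delta>_tendsto] unfolding eventually_sequentially by blast
    show ?thesis
    proof (intro exI[of _ N] allI impI)
      fix m l assume ml: "N \<le> m" "N \<le> l"
      have "b * (L2_norm \<Omega> (\<lambda>x. A (\<phi> m) x - A (\<phi> l) x))\<^sup>2 \<le> (sqrt (\<delta> m) + sqrt (\<delta> l))\<^sup>2"
        using A energy_Cauchy order_trans by blast
      also have "\<dots> \<le> 2 * \<delta> m + 2 * \<delta> l"
        using sum_squares_bound[of "sqrt (\<delta> m)" "sqrt (\<delta> l)"] \<delta>[of m] \<delta>[of l]
        by (simp add: power2_sum less_imp_le)
      also have "\<dots> \<le> b * \<epsilon>\<^sup>2" using N[OF ml(1)] N[OF ml(2)] by simp
      finally have "(L2_norm \<Omega> (\<lambda>x. A (\<phi> m) x - A (\<phi> l) x))\<^sup>2 \<le> \<epsilon>\<^sup>2" using b by simp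
      then show "L2_norm \<Omega> (\<lambda>x. A (\<phi> m) x - A (\<phi> l) x) \<le> \<epsilon>"
        by (rule power2_le_imp_le) (use \<epsilon> in simp)
    qed
  qed
  have "\<exists>u\<in>L2 \<Omega>. (\<lambda>m. L2_norm \<Omega> (\<lambda>x. \<phi> m x - u x)) \<longlonglongrightarrow> 0"
  proof (rule L2_complete[of \<phi> \<Omega>])
    show "\<phi> m \<in> L2 \<Omega>" for m by (intro test_fun_L2 open_domain \<phi>)
    show "\<exists>N. \<forall>m\<ge>N. \<forall>l\<ge>N. L2_norm \<Omega> (\<lambda>x. \<phi> m x - \<phi> l x) \<le> \<epsilon>" if "0 < \<epsilon>" for \<epsilon>
      using energy_L2[OF test_fun_diff[OF \<phi> \<phi>]] a that
      by (intro Cauchy[where A = "\<lambda>\<phi>. \<phi>" and b = a]) (auto simp: a_def)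
  qed auto
  then obtain u where u: "u \<in> L2 \<Omega>" "(\<lambda>m. L2_norm \<Omega> (\<lambda>x. \<phi> m x - u x)) \<longlonglongrightarrow> 0" by blast
  have "\<forall>k. \<exists>g. g \<in> L2 \<Omega> \<and> (\<lambda>m. L2_norm \<Omega> (\<lambda>x. pderiv_k k (\<phi> m) x - g x)) \<longlonglongrightarrow> 0"
  proof
    fix k
    show "\<exists>g. g \<in> L2 \<Omega> \<and> (\<lambda>m. L2_norm \<Omega> (\<lambda>x. pderiv_k k (\<phi> m) x - g x)) \<longlonglongrightarrow> 0"
    proof (rule L2_complete[of "\<lambda>m. pderiv_k k (\<phi> m)" \<Omega>])
      show "pderiv_k k (\<phi> m) \<in> L2 \<Omega>" for m by (intro test_fun_L2 open_domain test_fun_pderiv \<phi>)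
      show "\<exists>N. \<forall>m\<ge>N. \<forall>l\<ge>N. L2_norm \<Omega> (\<lambda>x. pderiv_k k (\<phi> m) x - pderiv_k k (\<phi> l) x) \<le> \<epsilon>" if "0 < \<epsilon>" for \<epsilon>
        using energy_coercive[OF test_fun_diff[OF \<phi> \<phi>], where k = k] weight_lower_pos that
        by (intro Cauchy[where A = "pderiv_k k" and b = \<alpha>]) (auto simp: pderiv_k_test_diff[OF \<phi> \<phi>])
    qed auto
  qed
  then obtain g where g: "\<And>k. g k \<in> L2 \<Omega>"
      "\<And>k. (\<lambda>m. L2_norm \<Omega> (\<lambda>x. pderiv_k k (\<phi> m) x - g k x)) \<longlonglongrightarrow> 0"
    using choice[of "\<lambda>k g. g \<in> L2 \<Omega> \<and> (\<lambda>m. L2_norm \<Omega> (\<lambda>x. pderiv_k k (\<phi> m) x - g x)) \<longlonglongrightarrow> 0"] by blast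
  have u_W: "u \<in> W1_0 \<Omega>" and ug: "\<And>k. (u, g k) \<in> weak_pderiv_graph \<Omega> k"
    using W1_0_limit[OF open_domain \<phi> u g] by auto
  have Re_eq: "Re (weighted_form \<Omega> w g (grad \<psi>)) = Re (L2_inner \<Omega> f \<psi>)" if \<psi>: "\<psi> \<in> test_funs \<Omega>" for \<psi>
  proof -
    have "(\<lambda>m. Re (weighted_form \<Omega> w (grad (\<phi> m)) (grad \<psi>)) - Re (L2_inner \<Omega> f \<psi>))
        \<longlonglongrightarrow> Re (weighted_form \<Omega> w g (grad \<psi>)) - Re (L2_inner \<Omega> f \<psi>)"
      unfolding weighted_form_def
      by (intro tendsto_diff tendsto_Re tendsto_sum tendsto_const L2_inner_tendsto(2) weight_L2 grad_L2 \<phi> \<psi> g)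
        (simp add: grad_def g)
    moreover have "(\<lambda>m. Re (weighted_form \<Omega> w (grad (\<phi> m)) (grad \<psi>)) - Re (L2_inner \<Omega> f \<psi>)) \<longlonglongrightarrow> 0"
    proof (rule Lim_null_comparison)
      show "\<forall>\<^sub>F m in sequentially. norm (Re (weighted_form \<Omega> w (grad (\<phi> m)) (grad \<psi>)) - Re (L2_inner \<Omega> f \<psi>))
          \<le> sqrt (\<delta> m) * sqrt (energy \<psi>)"
        using residual[OF \<psi>] by simp
      show "(\<lambda>m. sqrt (\<delta> m) * sqrt (energy \<psi>)) \<longlonglongrightarrow> 0"
        using tendsto_mult[OF tendsto_real_sqrt[OF \<delta>_tendsto] tendsto_const] by simp
    qed
    ultimately show ?thesis using LIMSEQ_unique by fastforce
  qed
  have solves: "weighted_form \<Omega> w g (grad \<psi>) = L2_inner \<Omega> f \<psi>" if \<psi>: "\<psi> \<in> test_funs \<Omega>" for \<psi>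
  proof (rule complex_eqI[OF Re_eq[OF \<psi>]])
    \<comment> \<open>the imaginary parts are the real parts for the test function \<open>- i \<psi>\<close>\<close>
    have "grad (\<lambda>x. - \<i> * \<psi> x) = (\<lambda>k x. - \<i> * grad \<psi> k x)"
      unfolding grad_def pderiv_k_test_scale[OF \<psi>] ..
    then show "Im (weighted_form \<Omega> w g (grad \<psi>)) = Im (L2_inner \<Omega> f \<psi>)"
      using Re_eq[OF test_fun_scale[OF \<psi>, of "- \<i>"]]
      by (simp only: weighted_form_scale_right L2_inner_scale_right) simp
  qed
  have "weighted_form \<Omega> w (weak_grad \<Omega> u) (grad \<psi>) = weighted_form \<Omega> w g (grad \<psi>)"
    if \<psi>: "\<psi> \<in> test_funs \<Omega>" for \<psi>
    unfolding weighted_form_def weak_grad_def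
  proof (intro sum.cong refl L2_inner_cong_AE)
    fix k
    show "AE x in lebesgue_on \<Omega>. weak_pderiv \<Omega> k u x = g k x"
      by (rule weak_pderiv_graph_unique[OF open_domain W1_weak_pderiv_graph[OF W1_0_W1[OF u_W]] ug])
  qed (auto intro: W1_L2 W1_0_W1 u_W g weight_L2 grad_L2 \<psi>)
  with u_W solves show ?thesis by (intro that[of u]) auto
qed

end

text \<open>
  Both sides are continuous in the second argument with respect to the norm of \<open>W1\<close>.  The extension
  is what allows a difference of two solutions to be inserted as a test function.
\<close>

lemma (in elliptic_weight) weak_equation_extends_to_W1_0:
  assumes u: "u \<in> W1_0 \<Omega>" and f: "f \<in> L2 \<Omega>"
    and eq: "\<And>\<psi>. \<psi> \<in> test_funs \<Omega> \<Longrightarrow> weighted_form \<Omega> w (weak_grad \<Omega> u) (grad \<psi>) = L2_inner \<Omega> f \<psi>"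
    and v: "v \<in> W1_0 \<Omega>"
  shows "weighted_form \<Omega> w (weak_grad \<Omega> u) (weak_grad \<Omega> v) = L2_inner \<Omega> f v"
proof -
  obtain \<phi> where \<phi>: "\<And>m::nat. \<phi> m \<in> test_funs \<Omega>" "(\<lambda>m. L2_norm \<Omega> (\<lambda>x. \<phi> m x - v x)) \<longlonglongrightarrow> 0"
    "\<And>k. (\<lambda>m. L2_norm \<Omega> (\<lambda>x. pderiv_k k (\<phi> m) x - weak_pderiv \<Omega> k v x)) \<longlonglongrightarrow> 0"
    by (rule W1_0_approximation[OF open_domain v]) (rule that)
  note v_L2 = W1_L2[OF W1_0_W1[OF v]] and u_L2 = W1_L2[OF W1_0_W1[OF u]]
  have "(\<lambda>m. weighted_form \<Omega> w (weak_grad \<Omega> u) (grad (\<phi> m)))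
      \<longlonglongrightarrow> weighted_form \<Omega> w (weak_grad \<Omega> u) (weak_grad \<Omega> v)"
    unfolding weighted_form_def L2_inner_mult_real[symmetric] weak_grad_def grad_def
    by (intro tendsto_sum L2_inner_tendsto(1) weight_L2 u_L2 v_L2 \<phi> test_fun_L2 open_domain test_fun_pderiv)
  moreover have "(\<lambda>m. weighted_form \<Omega> w (weak_grad \<Omega> u) (grad (\<phi> m))) \<longlonglongrightarrow> L2_inner \<Omega> f v"
    unfolding eq[OF \<phi>(1)]
    by (intro L2_inner_tendsto(1) f v_L2 \<phi> test_fun_L2 open_domain)
  ultimately show ?thesis by (rule LIMSEQ_unique)
qed

section \<open>The diffusion operators\<close>

lemma elliptic_weight_reciprocal:
  assumes "open \<Omega>" "p \<in> borel_measurable (lebesgue_on \<Omega>)" "0 < C1" "0 < C2"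
    and "AE x in lebesgue_on \<Omega>. C1 \<le> p x \<and> p x \<le> C2"
  shows "elliptic_weight \<Omega> (\<lambda>x. 1 / p x) (1 / C2) (1 / C1)"
proof
  show "(\<lambda>x. 1 / p x) \<in> borel_measurable (lebesgue_on \<Omega>)"
    using assms(2) by measurable
  show "AE x in lebesgue_on \<Omega>. 1 / C2 \<le> 1 / p x \<and> 1 / p x \<le> 1 / C1"
    using assms(5) by eventually_elim (use assms(3) in \<open>auto intro!: divide_left_mono mult_pos_pos\<close>)
qed (use assms in auto)

text \<open>
  The definition of the adjoint of the classical gradient, applied to \<open>1/p\<close> times the weak gradient,
  is the weak equation; the real weight can be moved to either side of the inner product.
\<close>

lemma diffusion_graph_iff_weak_equation:
  assumes "elliptic_weight \<Omega> (\<lambda>x. 1 / p x) \<alpha> \<beta>"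
  shows "(u, f) \<in> diffusion_graph \<Omega> p \<longleftrightarrow> u \<in> W1_0 \<Omega> \<and> f \<in> L2 \<Omega> \<and>
    (\<forall>\<psi>\<in>test_funs \<Omega>. weighted_form \<Omega> (\<lambda>x. 1 / p x) (weak_grad \<Omega> u) (grad \<psi>) = L2_inner \<Omega> f \<psi>)"
proof -
  interpret elliptic_weight \<Omega> "\<lambda>x. 1 / p x" \<alpha> \<beta> by fact
  have "weighted_grad \<Omega> p u \<in> L2k \<Omega>" if "u \<in> W1_0 \<Omega>"
    unfolding L2k_def weighted_grad_def weak_grad_def
    using weight_L2[OF W1_L2(2)[OF W1_0_W1[OF that]]] by simp
  moreover have "L2k_inner \<Omega> (weighted_grad \<Omega> p u) (grad \<psi>)
      = weighted_form \<Omega> (\<lambda>x. 1 / p x) (weak_grad \<Omega> u) (grad \<psi>)" for \<psi>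
    unfolding L2k_inner_def weighted_form_def weighted_grad_def L2_inner_mult_real ..
  ultimately show ?thesis
    unfolding diffusion_graph_def grad_adjoint_graph_def adjoint_graph_def by auto
qed

section \<open>Continuous dependence on the coefficient\<close>

text \<open>
  Subtracting the two weak equations and testing with the difference \<open>u' - u\<close> leaves the
  perturbation \<open>(w - w') \<nabla> u\<close> of the flux of the fixed solution \<open>u\<close>.
\<close>

lemma weak_solution_stability:
  assumes W: "elliptic_weight \<Omega> w \<alpha> \<beta>" and W': "elliptic_weight \<Omega> w' \<alpha>' \<beta>'"
    and u: "u \<in> W1_0 \<Omega>" and u': "u' \<in> W1_0 \<Omega>"
    and eq: "\<And>v. v \<in> W1_0 \<Omega> \<Longrightarrow> weighted_form \<Omega> w (weak_grad \<Omega> u) (weak_grad \<Omega> v) = L2_inner \<Omega> f v"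
    and eq': "\<And>v. v \<in> W1_0 \<Omega> \<Longrightarrow> weighted_form \<Omega> w' (weak_grad \<Omega> u') (weak_grad \<Omega> v) = L2_inner \<Omega> f v"
  shows "\<alpha>'\<^sup>2 * (\<Sum>k\<in>UNIV. (L2_norm \<Omega> (\<lambda>x. weak_pderiv \<Omega> k u' x - weak_pderiv \<Omega> k u x))\<^sup>2)
    \<le> (\<Sum>k\<in>UNIV. (L2_norm \<Omega> (\<lambda>x. complex_of_real (w' x - w x) * weak_pderiv \<Omega> k u x))\<^sup>2)"
proof -
  interpret W: elliptic_weight \<Omega> w \<alpha> \<beta> by fact
  interpret W': elliptic_weight \<Omega> w' \<alpha>' \<beta>' by fact
  note L2u = W1_L2(2)[OF W1_0_W1[OF u]] and L2u' = W1_L2(2)[OF W1_0_W1[OF u']]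
  define v where "v x = u' x - u x" for x
  have v: "v \<in> W1_0 \<Omega>" unfolding v_def by (intro W1_0_diff W.open_domain u u')
  define E where "E k x = weak_pderiv \<Omega> k u' x - weak_pderiv \<Omega> k u x" for k x
  define P where "P k x = complex_of_real (w' x - w x) * weak_pderiv \<Omega> k u x" for k x
  have E: "E k \<in> L2 \<Omega>" for k unfolding E_def by (intro L2_diff L2u L2u')
  have P_eq: "P k = (\<lambda>x. complex_of_real (w' x) * weak_pderiv \<Omega> k u x - complex_of_real (w x) * weak_pderiv \<Omega> k u x)" for k
    by (simp add: P_def left_diff_distrib fun_eq_iff)
  have P: "P k \<in> L2 \<Omega>" for k unfolding P_eq by (intro L2_diff W.weight_L2 W'.weight_L2 L2u)
  have AE_E: "AE x in lebesgue_on \<Omega>. weak_pderiv \<Omega> k v x = E k x" for k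
    unfolding v_def E_def using W1_diff(2)[OF W.open_domain W1_0_W1[OF u'] W1_0_W1[OF u]] .
  have form_E: "weighted_form \<Omega> \<omega> F (weak_grad \<Omega> v) = weighted_form \<Omega> \<omega> F E"
    if "elliptic_weight \<Omega> \<omega> a b" "\<And>k. F k \<in> L2 \<Omega>" for \<omega> a b F
  proof -
    interpret V: elliptic_weight \<Omega> \<omega> a b by fact
    show ?thesis
      unfolding weighted_form_def weak_grad_def
    proof (intro sum.cong refl L2_inner_cong_AE)
      fix k
      show "AE x in lebesgue_on \<Omega>. complex_of_real (\<omega> x) * weak_pderiv \<Omega> k v x = complex_of_real (\<omega> x) * E k x"
        using AE_E[of k] by eventually_elim simp
    qed (auto intro: that V.weight_L2 E W1_L2 W1_0_W1 v)
  qed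
  have "weighted_form \<Omega> w' (weak_grad \<Omega> u') E = weighted_form \<Omega> w (weak_grad \<Omega> u) E"
    using eq[OF v] eq'[OF v] form_E[OF W, of "weak_grad \<Omega> u"] form_E[OF W', of "weak_grad \<Omega> u'"]
    by (simp add: weak_grad_def L2u L2u')
  moreover have "weighted_form \<Omega> w' E E = weighted_form \<Omega> w' (weak_grad \<Omega> u') E - weighted_form \<Omega> w' (weak_grad \<Omega> u) E"
    unfolding E_def[abs_def] weak_grad_def
    by (intro W'.weighted_form_diff_left L2u L2u' L2_diff)
  ultimately have "weighted_form \<Omega> w' E E = weighted_form \<Omega> w (weak_grad \<Omega> u) E - weighted_form \<Omega> w' (weak_grad \<Omega> u) E"
    by simp
  also have "\<dots> = - (\<Sum>k\<in>UNIV. L2_inner \<Omega> (P k) (E k))"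
    unfolding P_eq weighted_form_def weak_grad_def L2_inner_mult_real[symmetric] sum_subtractf[symmetric] sum_negf[symmetric]
    by (intro sum.cong refl) (simp add: L2_inner_diff_left E W.weight_L2 W'.weight_L2 L2u)
  finally have "Re (weighted_form \<Omega> w' E E) = - (\<Sum>k\<in>UNIV. Re (L2_inner \<Omega> (P k) (E k)))"
    by simp
  also have "\<dots> \<le> (\<Sum>k\<in>UNIV. L2_norm \<Omega> (P k) * L2_norm \<Omega> (E k))"
    unfolding sum_negf[symmetric]
  proof (intro sum_mono)
    fix k
    show "- Re (L2_inner \<Omega> (P k) (E k)) \<le> L2_norm \<Omega> (P k) * L2_norm \<Omega> (E k)"
      using L2_Cauchy_Schwarz_Re[OF P E, of k k] by linarith
  qed
  finally have "\<alpha>' * (\<Sum>k\<in>UNIV. (L2_norm \<Omega> (E k))\<^sup>2) \<le> (\<Sum>k\<in>UNIV. L2_norm \<Omega> (P k) * L2_norm \<Omega> (E k))"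
    using W'.weighted_form_coercive[of E, OF E] by linarith
  then have "2 * \<alpha>' * (\<alpha>' * (\<Sum>k\<in>UNIV. (L2_norm \<Omega> (E k))\<^sup>2)) \<le> 2 * \<alpha>' * (\<Sum>k\<in>UNIV. L2_norm \<Omega> (P k) * L2_norm \<Omega> (E k))"
    using W'.weight_lower_pos by (intro mult_left_mono) auto
  also have "\<dots> = (\<Sum>k\<in>UNIV. 2 * L2_norm \<Omega> (P k) * (\<alpha>' * L2_norm \<Omega> (E k)))"
    by (simp add: sum_distrib_left mult_ac)
  \<comment> \<open>Young's inequality, scaled so that half of the left-hand side is absorbed\<close>
  also have "\<dots> \<le> (\<Sum>k\<in>UNIV. (L2_norm \<Omega> (P k))\<^sup>2 + (\<alpha>' * L2_norm \<Omega> (E k))\<^sup>2)"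
    by (intro sum_mono sum_squares_bound)
  also have "\<dots> = (\<Sum>k\<in>UNIV. (L2_norm \<Omega> (P k))\<^sup>2) + \<alpha>'\<^sup>2 * (\<Sum>k\<in>UNIV. (L2_norm \<Omega> (E k))\<^sup>2)"
    by (simp add: sum.distrib power_mult_distrib sum_distrib_left)
  finally have "\<alpha>'\<^sup>2 * (\<Sum>k\<in>UNIV. (L2_norm \<Omega> (E k))\<^sup>2) \<le> (\<Sum>k\<in>UNIV. (L2_norm \<Omega> (P k))\<^sup>2)"
    by (simp add: power2_eq_square mult.assoc)
  then show ?thesis unfolding E_def P_def .
qed

text \<open>
  Multiplication by \<open>a m\<close> need not tend to zero uniformly in \<open>g\<close>, since the multipliers need not
  converge uniformly.  For a fixed \<open>g\<close>, dominated convergence suffices.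
\<close>

lemma L2_norm_mult_tendsto_0:
  fixes a :: "nat \<Rightarrow> real ^ 'n::finite \<Rightarrow> real"
  assumes g: "g \<in> L2 \<Omega>" and a: "\<And>m. a m \<in> borel_measurable (lebesgue_on \<Omega>)"
    and bd: "\<And>m. AE x in lebesgue_on \<Omega>. \<bar>a m x\<bar> \<le> K"
    and lim: "AE x in lebesgue_on \<Omega>. (\<lambda>m. a m x) \<longlonglongrightarrow> 0"
  shows "(\<lambda>m. L2_norm \<Omega> (\<lambda>x. complex_of_real (a m x) * g x)) \<longlonglongrightarrow> 0"
proof -
  note [measurable] = L2_measurable[OF g] a
  have "(\<lambda>m. LINT x|lebesgue_on \<Omega>. (cmod (complex_of_real (a m x) * g x))\<^sup>2) \<longlonglongrightarrow> (LINT x|lebesgue_on \<Omega>. 0)"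
  proof (rule integral_dominated_convergence[where w = "\<lambda>x. K\<^sup>2 * (cmod (g x))\<^sup>2"])
    show "integrable (lebesgue_on \<Omega>) (\<lambda>x. K\<^sup>2 * (cmod (g x))\<^sup>2)"
      by (intro integrable_mult_right L2_integrable g)
    show "AE x in lebesgue_on \<Omega>. (\<lambda>m. (cmod (complex_of_real (a m x) * g x))\<^sup>2) \<longlonglongrightarrow> 0"
      using lim
    proof eventually_elim
      case (elim x)
      have "(\<lambda>m. (cmod (complex_of_real (a m x) * g x))\<^sup>2) \<longlonglongrightarrow> (cmod (complex_of_real 0 * g x))\<^sup>2"
        by (intro tendsto_power tendsto_norm tendsto_mult tendsto_of_real elim tendsto_const)
      then show ?case by simp
    qed
    show "AE x in lebesgue_on \<Omega>. norm ((cmod (complex_of_real (a m x) * g x))\<^sup>2) \<le> K\<^sup>2 * (cmod (g x))\<^sup>2" for m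
      using bd[of m]
    proof eventually_elim
      case (elim x)
      have "\<bar>a m x\<bar>\<^sup>2 * (cmod (g x))\<^sup>2 \<le> K\<^sup>2 * (cmod (g x))\<^sup>2"
        by (intro mult_right_mono power_mono elim) auto
      then show ?case by (simp add: norm_mult power_mult_distrib)
    qed
  qed measurable
  then have "(\<lambda>m. sqrt (LINT x|lebesgue_on \<Omega>. (cmod (complex_of_real (a m x) * g x))\<^sup>2)) \<longlonglongrightarrow> sqrt (LINT x|lebesgue_on \<Omega>. 0)"
    by (rule tendsto_real_sqrt)
  then show ?thesis by (simp add: L2_norm_def)
qed

lemma L2_norm_tendsto_0_of_le:
  assumes "b \<longlonglongrightarrow> 0" "\<And>m::nat. L2_norm \<Omega> (f m) \<le> b m"
  shows "(\<lambda>m. L2_norm \<Omega> (f m)) \<longlonglongrightarrow> 0"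
  by (rule tendsto_sandwich[OF _ _ tendsto_const assms(1)]) (use assms(2) in auto)

theorem weak_solutions_converge:
  fixes w :: "nat \<Rightarrow> real ^ 'n::finite \<Rightarrow> real"
  assumes W: "\<And>m. elliptic_weight \<Omega> (w m) \<alpha> \<beta>" and W\<^sub>0: "elliptic_weight \<Omega> w\<^sub>0 \<alpha>\<^sub>0 \<beta>\<^sub>0"
    and w_lim: "AE x in lebesgue_on \<Omega>. (\<lambda>m. w m x) \<longlonglongrightarrow> w\<^sub>0 x"
    and c: "0 < c" and poincare: "\<And>v. v \<in> W1_0 \<Omega> \<Longrightarrow> c * L2_norm \<Omega> v \<le> L2_norm \<Omega> (weak_pderiv \<Omega> j v)"
    and u: "\<And>m. u m \<in> W1_0 \<Omega>" and u\<^sub>0: "u\<^sub>0 \<in> W1_0 \<Omega>"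
    and eq: "\<And>m v. v \<in> W1_0 \<Omega> \<Longrightarrow> weighted_form \<Omega> (w m) (weak_grad \<Omega> (u m)) (weak_grad \<Omega> v) = L2_inner \<Omega> f v"
    and eq\<^sub>0: "\<And>v. v \<in> W1_0 \<Omega> \<Longrightarrow> weighted_form \<Omega> w\<^sub>0 (weak_grad \<Omega> u\<^sub>0) (weak_grad \<Omega> v) = L2_inner \<Omega> f v"
  shows "(\<lambda>m. L2_norm \<Omega> (\<lambda>x. u m x - u\<^sub>0 x)) \<longlonglongrightarrow> 0"
    and "(\<lambda>m. L2_norm \<Omega> (\<lambda>x. complex_of_real (w m x) * weak_grad \<Omega> (u m) k x
      - complex_of_real (w\<^sub>0 x) * weak_grad \<Omega> u\<^sub>0 k x)) \<longlonglongrightarrow> 0"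
proof -
  interpret W: elliptic_weight \<Omega> "w m" \<alpha> \<beta> for m by (rule W)
  interpret W\<^sub>0: elliptic_weight \<Omega> w\<^sub>0 \<alpha>\<^sub>0 \<beta>\<^sub>0 by (rule W\<^sub>0)
  note L2u = W1_L2(2)[OF W1_0_W1[OF u]] and L2u\<^sub>0 = W1_L2(2)[OF W1_0_W1[OF u\<^sub>0]]
  define E where "E m k x = weak_pderiv \<Omega> k (u m) x - weak_pderiv \<Omega> k u\<^sub>0 x" for m k x
  define P where "P m k x = complex_of_real (w m x - w\<^sub>0 x) * weak_pderiv \<Omega> k u\<^sub>0 x" for m k x
  have E: "E m k \<in> L2 \<Omega>" for m k unfolding E_def by (intro L2_diff L2u L2u\<^sub>0)
  have bd: "AE x in lebesgue_on \<Omega>. \<bar>w m x - w\<^sub>0 x\<bar> \<le> \<bar>\<beta>\<bar> + \<bar>\<beta>\<^sub>0\<bar>" for m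
    using W.cmod_weight_le[of m] W\<^sub>0.cmod_weight_le by eventually_elim simp
  have P_lim: "(\<lambda>m. L2_norm \<Omega> (P m k)) \<longlonglongrightarrow> 0" for k
    unfolding P_def
  proof (rule L2_norm_mult_tendsto_0[OF L2u\<^sub>0 _ bd])
    show "(\<lambda>x. w m x - w\<^sub>0 x) \<in> borel_measurable (lebesgue_on \<Omega>)" for m
      by (intro borel_measurable_diff W.weight_measurable W\<^sub>0.weight_measurable)
    show "AE x in lebesgue_on \<Omega>. (\<lambda>m. w m x - w\<^sub>0 x) \<longlonglongrightarrow> 0"
      using w_lim by eventually_elim (simp add: LIM_zero_iff)
  qed
  have P: "P m k \<in> L2 \<Omega>" for m k
    unfolding P_def
  proof (rule L2_mult_bounded[OF L2u\<^sub>0])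
    show "(\<lambda>x. complex_of_real (w m x - w\<^sub>0 x)) \<in> borel_measurable (lebesgue_on \<Omega>)"
      using W.weight_measurable[of m] W\<^sub>0.weight_measurable by measurable
    show "AE x in lebesgue_on \<Omega>. cmod (complex_of_real (w m x - w\<^sub>0 x)) \<le> \<bar>\<beta>\<bar> + \<bar>\<beta>\<^sub>0\<bar>"
      using bd[of m] by (simp only: norm_of_real)
  qed
  have E_lim: "(\<lambda>m. L2_norm \<Omega> (E m k)) \<longlonglongrightarrow> 0" for k
  proof -
    have "(\<lambda>m. sqrt ((\<Sum>k\<in>UNIV. (L2_norm \<Omega> (P m k))\<^sup>2) / \<alpha>\<^sup>2)) \<longlonglongrightarrow> sqrt ((\<Sum>k\<in>(UNIV::'n set). 0\<^sup>2) / \<alpha>\<^sup>2)"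
      using W.weight_lower_pos
      by (intro tendsto_real_sqrt tendsto_divide tendsto_sum tendsto_power P_lim tendsto_const) auto
    moreover have "L2_norm \<Omega> (E m k) \<le> sqrt ((\<Sum>k\<in>UNIV. (L2_norm \<Omega> (P m k))\<^sup>2) / \<alpha>\<^sup>2)" for m
    proof (rule real_le_rsqrt)
      have "(L2_norm \<Omega> (E m k))\<^sup>2 \<le> (\<Sum>k\<in>UNIV. (L2_norm \<Omega> (E m k))\<^sup>2)"
        by (rule member_le_sum) auto
      also have "\<dots> \<le> (\<Sum>k\<in>UNIV. (L2_norm \<Omega> (P m k))\<^sup>2) / \<alpha>\<^sup>2"
        using weak_solution_stability[OF W\<^sub>0 W u\<^sub>0 u eq\<^sub>0 eq, of m] W.weight_lower_pos
        unfolding E_def[symmetric] P_def[symmetric]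
        by (simp add: pos_le_divide_eq mult.commute)
      finally show "(L2_norm \<Omega> (E m k))\<^sup>2 \<le> (\<Sum>k\<in>UNIV. (L2_norm \<Omega> (P m k))\<^sup>2) / \<alpha>\<^sup>2" .
    qed
    ultimately show ?thesis by (intro L2_norm_tendsto_0_of_le) simp_all
  qed
  have "L2_norm \<Omega> (\<lambda>x. u m x - u\<^sub>0 x) \<le> L2_norm \<Omega> (E m j) / c" for m
  proof -
    have v: "(\<lambda>x. u m x - u\<^sub>0 x) \<in> W1_0 \<Omega>" by (intro W1_0_diff W.open_domain u u\<^sub>0)
    have "L2_norm \<Omega> (weak_pderiv \<Omega> j (\<lambda>x. u m x - u\<^sub>0 x)) = L2_norm \<Omega> (E m j)"
      using W1_diff(2)[OF W\<^sub>0.open_domain W1_0_W1[OF u] W1_0_W1[OF u\<^sub>0]]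
      unfolding E_def[symmetric] by (intro L2_norm_cong_AE E W1_L2 W1_0_W1 v)
    then show ?thesis using poincare[OF v] c by (simp add: pos_le_divide_eq mult.commute)
  qed
  moreover have "(\<lambda>m. L2_norm \<Omega> (E m j) / c) \<longlonglongrightarrow> 0"
    using tendsto_divide[OF E_lim tendsto_const, of c j] c by simp
  ultimately show "(\<lambda>m. L2_norm \<Omega> (\<lambda>x. u m x - u\<^sub>0 x)) \<longlonglongrightarrow> 0"
    by (rule L2_norm_tendsto_0_of_le[rotated])
  have "L2_norm \<Omega> (\<lambda>x. complex_of_real (w m x) * weak_grad \<Omega> (u m) k x
      - complex_of_real (w\<^sub>0 x) * weak_grad \<Omega> u\<^sub>0 k x) \<le> \<bar>\<beta>\<bar> * L2_norm \<Omega> (E m k) + L2_norm \<Omega> (P m k)" for m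
  proof -
    have "(\<lambda>x. complex_of_real (w m x) * weak_grad \<Omega> (u m) k x - complex_of_real (w\<^sub>0 x) * weak_grad \<Omega> u\<^sub>0 k x)
        = (\<lambda>x. complex_of_real (w m x) * E m k x + P m k x)"
      by (simp add: E_def P_def weak_grad_def algebra_simps fun_eq_iff)
    then show ?thesis
      using L2_norm_triangle[OF W.weight_L2[OF E] P, of m m k m k] W.weight_L2_norm[OF E, of m m k] by simp
  qed
  moreover have "(\<lambda>m. \<bar>\<beta>\<bar> * L2_norm \<Omega> (E m k) + L2_norm \<Omega> (P m k)) \<longlonglongrightarrow> 0"
    using tendsto_add[OF tendsto_mult[OF tendsto_const E_lim] P_lim] by simp
  ultimately show "(\<lambda>m. L2_norm \<Omega> (\<lambda>x. complex_of_real (w m x) * weak_grad \<Omega> (u m) k x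
      - complex_of_real (w\<^sub>0 x) * weak_grad \<Omega> u\<^sub>0 k x)) \<longlonglongrightarrow> 0"
    by (rule L2_norm_tendsto_0_of_le[rotated])
qed

text \<open>
  Since \<open>f\<close> is in the range of the operator, the choice in \<open>diffusion_inverse\<close> picks a solution of
  the weak equation.
\<close>

lemma diffusion_inverse_solves:
  assumes W: "elliptic_weight \<Omega> (\<lambda>x. 1 / p x) \<alpha> \<beta>" and f: "f \<in> L2 \<Omega>"
    and c: "0 < c" and poincare: "\<And>v. v \<in> W1_0 \<Omega> \<Longrightarrow> c * L2_norm \<Omega> v \<le> L2_norm \<Omega> (weak_pderiv \<Omega> j v)"
  shows "diffusion_inverse \<Omega> p f \<in> W1_0 \<Omega>"
    and "v \<in> W1_0 \<Omega> \<Longrightarrow>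
      weighted_form \<Omega> (\<lambda>x. 1 / p x) (weak_grad \<Omega> (diffusion_inverse \<Omega> p f)) (weak_grad \<Omega> v) = L2_inner \<Omega> f v"
proof -
  interpret elliptic_weight \<Omega> "\<lambda>x. 1 / p x" \<alpha> \<beta> by (rule W)
  have "c * L2_norm \<Omega> \<phi> \<le> L2_norm \<Omega> (pderiv_k j \<phi>)" if \<phi>: "\<phi> \<in> test_funs \<Omega>" for \<phi>
  proof -
    note W1_0 = test_fun_W1_0[OF open_domain \<phi>]
    have "L2_norm \<Omega> (weak_pderiv \<Omega> j \<phi>) = L2_norm \<Omega> (pderiv_k j \<phi>)"
      using weak_pderiv_graph_unique[OF open_domain W1_weak_pderiv_graph[OF W1_0_W1[OF W1_0]]
          test_fun_weak_pderiv_graph[OF open_domain \<phi>]]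
      by (intro L2_norm_cong_AE W1_L2 W1_0_W1 W1_0 test_fun_L2 open_domain test_fun_pderiv \<phi>)
    with poincare[OF W1_0] show ?thesis by simp
  qed
  then obtain u where "u \<in> W1_0 \<Omega>"
    "\<And>\<psi>. \<psi> \<in> test_funs \<Omega> \<Longrightarrow> weighted_form \<Omega> (\<lambda>x. 1 / p x) (weak_grad \<Omega> u) (grad \<psi>) = L2_inner \<Omega> f \<psi>"
    using weak_solution_exists[OF f c] by blast
  then have "(f, u) \<in> (diffusion_graph \<Omega> p)\<inverse>"
    using f by (simp add: diffusion_graph_iff_weak_equation[OF W])
  then have "(f, diffusion_inverse \<Omega> p f) \<in> (diffusion_graph \<Omega> p)\<inverse>"
    unfolding diffusion_inverse_def by (rule op_apply_graph)
  then have *: "diffusion_inverse \<Omega> p f \<in> W1_0 \<Omega>" "\<And>\<psi>. \<psi> \<in> test_funs \<Omega> \<Longrightarrow>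
      weighted_form \<Omega> (\<lambda>x. 1 / p x) (weak_grad \<Omega> (diffusion_inverse \<Omega> p f)) (grad \<psi>) = L2_inner \<Omega> f \<psi>"
    by (auto simp: diffusion_graph_iff_weak_equation[OF W])
  show "diffusion_inverse \<Omega> p f \<in> W1_0 \<Omega>" by (rule *(1))
  show "weighted_form \<Omega> (\<lambda>x. 1 / p x) (weak_grad \<Omega> (diffusion_inverse \<Omega> p f)) (weak_grad \<Omega> v) = L2_inner \<Omega> f v"
    if "v \<in> W1_0 \<Omega>"
    by (rule weak_equation_extends_to_W1_0[OF *(1) f *(2) that])
qed

lemma Linf_norm_AE_bound:
  assumes "Linf_norm \<Omega> q \<le> ereal M"
  shows "AE x in lebesgue_on \<Omega>. \<bar>q x\<bar> \<le> M"
  using esssup_AE[of "\<lambda>x. ereal \<bar>q x\<bar>" "lebesgue_on \<Omega>"]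
proof eventually_elim
  case (elim x)
  then have "ereal \<bar>q x\<bar> \<le> ereal M" using assms unfolding Linf_norm_def by (rule order_trans)
  then show ?case by simp
qed

theorem corollary5p0p8:
  fixes \<Omega> :: "(real ^ 'n::finite) set"
    and p :: "nat \<Rightarrow> real ^ 'n \<Rightarrow> real"
    and p_inf :: "real ^ 'n \<Rightarrow> real"
  assumes "open \<Omega>" and "\<Omega> \<noteq> {}"
    and "\<exists>j. \<exists>c>0. \<forall>f\<in>W1_0 \<Omega>. L2_norm \<Omega> (weak_pderiv \<Omega> j f) \<ge> c * L2_norm \<Omega> f"
    and "\<forall>\<nu>\<ge>1. p \<nu> \<in> coeffs_L \<Omega>"
    and "(SUP \<nu>\<in>{1..}. Linf_norm \<Omega> (p \<nu>)) < \<infinity>"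
    and "\<exists>\<epsilon>>0. \<forall>\<nu>\<ge>1. AE x in lebesgue_on \<Omega>. p \<nu> x \<ge> \<epsilon>"
    and "p_inf \<in> coeffs_L \<Omega>"
    and "AE x in lebesgue_on \<Omega>. (\<lambda>\<nu>. p \<nu> x) \<longlonglongrightarrow> p_inf x"
  shows "\<forall>f\<in>L2 \<Omega>.
    (\<lambda>\<nu>. L2_norm \<Omega> (\<lambda>x. diffusion_inverse \<Omega> (p \<nu>) f x - diffusion_inverse \<Omega> p_inf f x))
      \<longlonglongrightarrow> 0 \<and>
    (\<lambda>\<nu>. L2k_norm \<Omega> (\<lambda>k x. weighted_grad \<Omega> (p \<nu>) (diffusion_inverse \<Omega> (p \<nu>) f) k x
                          - weighted_grad \<Omega> p_inf (diffusion_inverse \<Omega> p_inf f) k x))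
      \<longlonglongrightarrow> 0"
proof
  fix f assume f: "f \<in> L2 \<Omega>"
  obtain j c where c: "0 < c"
    and poincare: "\<And>v. v \<in> W1_0 \<Omega> \<Longrightarrow> c * L2_norm \<Omega> v \<le> L2_norm \<Omega> (weak_pderiv \<Omega> j v)"
    using assms(3) by blast
  obtain \<epsilon> where \<epsilon>: "0 < \<epsilon>" and lower: "\<And>\<nu>. 1 \<le> \<nu> \<Longrightarrow> AE x in lebesgue_on \<Omega>. \<epsilon> \<le> p \<nu> x"
    using assms(6) by blast
  obtain M where M: "0 < M" and upper: "\<And>\<nu>. 1 \<le> \<nu> \<Longrightarrow> AE x in lebesgue_on \<Omega>. \<bar>p \<nu> x\<bar> \<le> M"
  proof -
    obtain M where M: "(SUP \<nu>\<in>{1..}. Linf_norm \<Omega> (p \<nu>)) \<le> ereal M"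
      using assms(5) less_PInf_Ex_of_nat[of "SUP \<nu>\<in>{1..}. Linf_norm \<Omega> (p \<nu>)"] by (auto dest: less_imp_le)
    show ?thesis
    proof (rule that[of "max M 1"])
      fix \<nu> :: nat assume "1 \<le> \<nu>"
      then have "Linf_norm \<Omega> (p \<nu>) \<le> (SUP \<nu>\<in>{1..}. Linf_norm \<Omega> (p \<nu>))" by (intro SUP_upper) simp
      also have "\<dots> \<le> ereal (max M 1)" using M by (simp add: max.coboundedI1)
      finally show "AE x in lebesgue_on \<Omega>. \<bar>p \<nu> x\<bar> \<le> max M 1" by (rule Linf_norm_AE_bound)
    qed simp
  qed
  obtain C1 C2 where C: "0 < C1" "C1 \<le> C2" "AE x in lebesgue_on \<Omega>. C1 \<le> p_inf x \<and> p_inf x \<le> C2"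
    using assms(7) by (auto simp: coeffs_L_def)
  have W\<^sub>0: "elliptic_weight \<Omega> (\<lambda>x. 1 / p_inf x) (1 / C2) (1 / C1)"
    using assms(7) C by (intro elliptic_weight_reciprocal assms(1)) (auto simp: coeffs_L_def Linf_def)
  \<comment> \<open>the bounds start at index \<open>1\<close>, hence the shift\<close>
  have W: "elliptic_weight \<Omega> (\<lambda>x. 1 / p (Suc m) x) (1 / M) (1 / \<epsilon>)" for m
  proof (rule elliptic_weight_reciprocal[OF assms(1) _ \<epsilon> M])
    show "p (Suc m) \<in> borel_measurable (lebesgue_on \<Omega>)"
      using assms(4) by (auto simp: coeffs_L_def Linf_def)
    show "AE x in lebesgue_on \<Omega>. \<epsilon> \<le> p (Suc m) x \<and> p (Suc m) x \<le> M"
      using lower[of "Suc m", simplified] upper[of "Suc m", simplified] by eventually_elim simp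
  qed
  have w_lim: "AE x in lebesgue_on \<Omega>. (\<lambda>m. 1 / p (Suc m) x) \<longlonglongrightarrow> 1 / p_inf x"
    using assms(8) C(3)
  proof eventually_elim
    case (elim x)
    then have "p_inf x \<noteq> 0" using C(1) by auto
    then show ?case using elim(1) by (intro tendsto_divide tendsto_const LIMSEQ_Suc)
  qed
  note solves = diffusion_inverse_solves[OF W f c poincare]
    and solves\<^sub>0 = diffusion_inverse_solves[OF W\<^sub>0 f c poincare]
  note conv = weak_solutions_converge[OF W W\<^sub>0 w_lim c poincare solves(1) solves\<^sub>0(1) solves(2) solves\<^sub>0(2)]
  show "(\<lambda>\<nu>. L2_norm \<Omega> (\<lambda>x. diffusion_inverse \<Omega> (p \<nu>) f x - diffusion_inverse \<Omega> p_inf f x))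
      \<longlonglongrightarrow> 0 \<and>
    (\<lambda>\<nu>. L2k_norm \<Omega> (\<lambda>k x. weighted_grad \<Omega> (p \<nu>) (diffusion_inverse \<Omega> (p \<nu>) f) k x
                          - weighted_grad \<Omega> p_inf (diffusion_inverse \<Omega> p_inf f) k x))
      \<longlonglongrightarrow> 0"
  proof
    show "(\<lambda>\<nu>. L2_norm \<Omega> (\<lambda>x. diffusion_inverse \<Omega> (p \<nu>) f x - diffusion_inverse \<Omega> p_inf f x)) \<longlonglongrightarrow> 0"
      by (rule LIMSEQ_imp_Suc) (rule conv(1))
    show "(\<lambda>\<nu>. L2k_norm \<Omega> (\<lambda>k x. weighted_grad \<Omega> (p \<nu>) (diffusion_inverse \<Omega> (p \<nu>) f) k x
        - weighted_grad \<Omega> p_inf (diffusion_inverse \<Omega> p_inf f) k x)) \<longlonglongrightarrow> 0"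
    proof (rule LIMSEQ_imp_Suc)
      have "(\<lambda>m. L2k_norm \<Omega> (\<lambda>k x. weighted_grad \<Omega> (p (Suc m)) (diffusion_inverse \<Omega> (p (Suc m)) f) k x
        - weighted_grad \<Omega> p_inf (diffusion_inverse \<Omega> p_inf f) k x)) \<longlonglongrightarrow> sqrt (\<Sum>k\<in>(UNIV::'n set). 0\<^sup>2)"
        unfolding L2k_norm_def weighted_grad_def
        by (intro tendsto_real_sqrt tendsto_sum tendsto_power conv(2))
      then show "(\<lambda>m. L2k_norm \<Omega> (\<lambda>k x. weighted_grad \<Omega> (p (Suc m)) (diffusion_inverse \<Omega> (p (Suc m)) f) k x
        - weighted_grad \<Omega> p_inf (diffusion_inverse \<Omega> p_inf f) k x)) \<longlonglongrightarrow> 0"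
        by simp
    qed
  qed
qed

end
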